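(* There is a (randomized) polynomial-time $\tilde{O}(\sqrt{n})$-approximation algorithm for Constrained Connectivity-Sum on $K_n$, and likewise for Constrained Connectivity-Degree on $K_n$.
   Context: Constrained Connectivity: given a graph $G=(V,E)$, $n=|V|$, and for each ordered pair $(u,v)\in V\times V$ a set $S(u,v)\subseteq V$ (the safe set) with $u,v\in S(u,v)$. A subgraph $H=(V,F)$ of $G$ is safely connected if for every ordered pair $(u,v)$ there is a $u$–$v$ path in $H$ all of whose vertices lie in $S(u,v)$. Constrained Connectivity-Sum asks for a safely connected subgraph minimizing $|F|$; Constrained Connectivity-Degree asks for a safely connected subgraph minimizing the maximum degree. "On $K_n$" means $G$ is the complete graph on $V$ (safe sets arbitrary). An $\alpha$-approximation outputs (with high probability) a safely connected subgraph whose cost is at most $\alpha$ times the optimum. $\tilde{O}$ hides polylogarithmic factors in $n$. *)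

theory Defs
  imports
    "HOL-Probability.Probability"
    "HOL-Library.Landau_Symbols"
    "HOL-Library.Ramsey"
    "HOL-Computational_Algebra.Polynomial"
begin

section \<open>Constrained connectivity\<close>

text \<open>An undirected simple graph on a vertex set \<open>V\<close> is given by its edge set
  \<open>E \<subseteq> [V]\<^bsup>2\<^esup>\<close>; thus the complete graph on \<open>V\<close> has edge set \<open>[V]\<^bsup>2\<^esup>\<close>.\<close>

definition is_path :: "'a set set \<Rightarrow> 'a \<Rightarrow> 'a list \<Rightarrow> 'a \<Rightarrow> bool" where
  "is_path F u p v \<longleftrightarrow>
     p \<noteq> [] \<and> hd p = u \<and> last p = v \<and> distinct p \<and> successively (\<lambda>x y. {x, y} \<in> F) p"

definition safe_sets :: "'a set \<Rightarrow> ('a \<Rightarrow> 'a \<Rightarrow> 'a set) \<Rightarrow> bool" where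
  "safe_sets V S \<longleftrightarrow> (\<forall>u\<in>V. \<forall>v\<in>V. S u v \<subseteq> V \<and> u \<in> S u v \<and> v \<in> S u v)"

definition safely_connected :: "'a set \<Rightarrow> ('a \<Rightarrow> 'a \<Rightarrow> 'a set) \<Rightarrow> 'a set set \<Rightarrow> bool" where
  "safely_connected V S F \<longleftrightarrow>
     (\<forall>u\<in>V. \<forall>v\<in>V. \<exists>p. is_path F u p v \<and> set p \<subseteq> S u v)"

definition solutions :: "'a set \<Rightarrow> 'a set set \<Rightarrow> ('a \<Rightarrow> 'a \<Rightarrow> 'a set) \<Rightarrow> 'a set set set" where
  "solutions V E S = {F. F \<subseteq> E \<and> safely_connected V S F}"

definition num_edges :: "'a set \<Rightarrow> 'a set set \<Rightarrow> nat" where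
  "num_edges V F = card F"

definition vertex_degree :: "'a set set \<Rightarrow> 'a \<Rightarrow> nat" where
  "vertex_degree F v = card {e \<in> F. v \<in> e}"

definition max_degree :: "'a set \<Rightarrow> 'a set set \<Rightarrow> nat" where
  "max_degree V F = Max (vertex_degree F ` V)"

text \<open>The optimum is only meaningful if there is a solution; on a complete graph there
  always is one (lemma \<open>complete_graph_solution\<close> below).\<close>

definition opt ::
  "('a set \<Rightarrow> 'a set set \<Rightarrow> nat) \<Rightarrow> 'a set \<Rightarrow> 'a set set \<Rightarrow> ('a \<Rightarrow> 'a \<Rightarrow> 'a set) \<Rightarrow> nat" where
  "opt cost V E S = (INF F \<in> solutions V E S. cost V F)"

lemma complete_graph_solution:
  assumes "safe_sets V S"
  shows "[V]\<^bsup>2\<^esup> \<in> solutions V ([V]\<^bsup>2\<^esup>) S"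
  unfolding solutions_def safely_connected_def
proof (intro CollectI conjI ballI subset_refl)
  fix u v assume uv: "u \<in> V" "v \<in> V"
  show "\<exists>p. is_path ([V]\<^bsup>2\<^esup>) u p v \<and> set p \<subseteq> S u v"
  proof (cases "u = v")
    case True
    with uv assms show ?thesis
      by (intro exI[of _ "[u]"]) (auto simp: is_path_def safe_sets_def)
  next
    case False
    with uv assms show ?thesis
      by (intro exI[of _ "[u, v]"]) (auto simp: is_path_def safe_sets_def nsets_def)
  qed
qed

section \<open>Randomized random access machines\<close>

text \<open>The machine model is a random access machine with coin tosses and finitely many
  memory arrays, programmed in a structured while language. All memory cells hold natural
  numbers; a scalar variable \<open>x\<close> is the cell \<open>x[0]\<close>. Every command costs one time unit.
  Expressions have constant size in a fixed program and are built from constants, memory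
  reads, addition and truncated subtraction only. Without a unit-cost multiplication, the
  numbers occurring within \<open>t\<close> steps have \<open>O(t)\<close> bits more than those in the input, so
  polynomial time here coincides with polynomial time on Turing machines.\<close>

type_synonym vname = string
type_synonym state = "vname \<Rightarrow> nat \<Rightarrow> nat"

datatype aexp = Const nat | Cell vname aexp | Plus aexp aexp | Minus aexp aexp

datatype bexp = Less aexp aexp | Neg bexp | Conj bexp bexp

datatype com =
    Skip
  | Assign vname aexp aexp
  | Toss vname aexp
  | Seq com com
  | Cond bexp com com
  | While bexp com

primrec aval :: "aexp \<Rightarrow> state \<Rightarrow> nat" where
  "aval (Const k) s = k"
| "aval (Cell x i) s = s x (aval i s)"
| "aval (Plus a b) s = aval a s + aval b s"
| "aval (Minus a b) s = aval a s - aval b s"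

primrec bval :: "bexp \<Rightarrow> state \<Rightarrow> bool" where
  "bval (Less a b) s = (aval a s < aval b s)"
| "bval (Neg b) s = (\<not> bval b s)"
| "bval (Conj b c) s = (bval b s \<and> bval c s)"

definition upd :: "state \<Rightarrow> vname \<Rightarrow> nat \<Rightarrow> nat \<Rightarrow> state" where
  "upd s x i k = s(x := (s x)(i := k))"

text \<open>\<open>exec c s r t s' r'\<close>: started in memory \<open>s\<close> with the random bits \<open>r\<close> still available, \<open>c\<close>
  terminates after exactly \<open>t\<close> steps in memory \<open>s'\<close>, leaving the random bits \<open>r'\<close> unread.
  A coin toss on an exhausted random tape is stuck, i.e. does not terminate.\<close>

inductive exec :: "com \<Rightarrow> state \<Rightarrow> bool list \<Rightarrow> nat \<Rightarrow> state \<Rightarrow> bool list \<Rightarrow> bool" where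
  Skip: "exec Skip s r 1 s r"
| Assign: "exec (Assign x i a) s r 1 (upd s x (aval i s) (aval a s)) r"
| Toss: "exec (Toss x i) s (b # r) 1 (upd s x (aval i s) (of_bool b)) r"
| Seq: "exec c1 s r t1 s1 r1 \<Longrightarrow> exec c2 s1 r1 t2 s2 r2 \<Longrightarrow>
    exec (Seq c1 c2) s r (1 + t1 + t2) s2 r2"
| CondTrue: "bval b s \<Longrightarrow> exec c1 s r t s' r' \<Longrightarrow> exec (Cond b c1 c2) s r (1 + t) s' r'"
| CondFalse: "\<not> bval b s \<Longrightarrow> exec c2 s r t s' r' \<Longrightarrow> exec (Cond b c1 c2) s r (1 + t) s' r'"
| WhileFalse: "\<not> bval b s \<Longrightarrow> exec (While b c) s r 1 s r"
| WhileTrue: "bval b s \<Longrightarrow> exec c s r t1 s1 r1 \<Longrightarrow> exec (While b c) s1 r1 t2 s2 r2 \<Longrightarrow>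
    exec (While b c) s r (1 + t1 + t2) s2 r2"

inductive_cases SkipE: "exec Skip s r t s' r'"
inductive_cases AssignE: "exec (Assign x i a) s r t s' r'"
inductive_cases TossE: "exec (Toss x i) s r t s' r'"
inductive_cases SeqE: "exec (Seq c1 c2) s r t s' r'"
inductive_cases CondE: "exec (Cond b c1 c2) s r t s' r'"
inductive_cases WhileE: "exec (While b c) s r t s' r'"

lemma exec_deterministic:
  "exec c s r t s1 r1 \<Longrightarrow> exec c s r u s2 r2 \<Longrightarrow> t = u \<and> s1 = s2 \<and> r1 = r2"
proof (induction arbitrary: u s2 r2 rule: exec.induct)
  case Skip then show ?case by (auto elim: SkipE)
next
  case Assign then show ?case by (auto elim: AssignE)
next
  case Toss then show ?case by (auto elim: TossE)
next
  case (Seq c1 s r t1 s1 r1 c2 t2 s' r')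
  from Seq.prems obtain u1 u2 s3 r3 where
    "u = Suc (u1 + u2)" "exec c1 s r u1 s3 r3" "exec c2 s3 r3 u2 s2 r2"
    by (blast elim: SeqE)
  with Seq.IH(1)[of u1 s3 r3] Seq.IH(2)[of u2 s2 r2] show ?case by simp
next
  case (CondTrue b s c1 r t s' r' c2)
  from CondTrue.prems CondTrue.hyps(1) obtain u1 where "u = Suc u1" "exec c1 s r u1 s2 r2"
    by (blast elim: CondE)
  with CondTrue.IH[of u1 s2 r2] show ?case by simp
next
  case (CondFalse b s c2 r t s' r' c1)
  from CondFalse.prems CondFalse.hyps(1) obtain u1 where "u = Suc u1" "exec c2 s r u1 s2 r2"
    by (blast elim: CondE)
  with CondFalse.IH[of u1 s2 r2] show ?case by simp
next
  case WhileFalse then show ?case by (auto elim: WhileE)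
next
  case (WhileTrue b s c r t1 s1 r1 t2 s' r')
  from WhileTrue.prems WhileTrue.hyps(1) obtain u1 u2 s3 r3 where
    "u = Suc (u1 + u2)" "exec c s r u1 s3 r3" "exec (While b c) s3 r3 u2 s2 r2"
    by (blast elim: WhileE)
  with WhileTrue.IH(1)[of u1 s3 r3] WhileTrue.IH(2)[of u2 s2 r2] show ?case by simp
qed

section \<open>Approximation algorithms on complete graphs\<close>

text \<open>An instance on the complete graph with vertices \<open>0, \<dots>, n - 1\<close> is presented by \<open>n\<close> and the
  characteristic function of \<open>{(u, v, w). w \<in> S u v}\<close>, so its size is polynomial in \<open>n\<close>. All
  other memory is initially zero.\<close>

definition encode :: "nat \<Rightarrow> (nat \<Rightarrow> nat \<Rightarrow> nat set) \<Rightarrow> state" where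
  "encode n S = (\<lambda>x i.
     if x = ''n'' then (if i = 0 then n else 0)
     else if x = ''S'' then
       of_bool (\<exists>u<n. \<exists>v<n. \<exists>w<n. i = (u * n + v) * n + w \<and> w \<in> S u v)
     else 0)"

definition output_edges :: "nat \<Rightarrow> state \<Rightarrow> nat set set" where
  "output_edges n s = {{u, v} | u v. u < n \<and> v < n \<and> u \<noteq> v \<and> s ''F'' (u * n + v) \<noteq> 0}"

text \<open>On every input with \<open>n\<close> vertices and for every outcome of the coin tosses, the program halts
  within \<open>poly p n\<close> steps. It hence tosses at most \<open>poly p n\<close> coins, so a uniformly random tape of
  that length suffices.\<close>

definition polynomial_time :: "com \<Rightarrow> nat poly \<Rightarrow> bool" where
  "polynomial_time c p \<longleftrightarrow>
     (\<forall>n\<ge>1. \<forall>S. safe_sets {..<n} S \<longrightarrow>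
       (\<forall>r. length r = poly p n \<longrightarrow> (\<exists>t s' r'. exec c (encode n S) r t s' r' \<and> t \<le> poly p n)))"

text \<open>With probability at least \<open>1 - 1 / n ^ d\<close>, the output is a solution whose cost is within the
  factor \<open>\<alpha> n\<close> of the optimum.\<close>

definition approximates ::
  "(nat set \<Rightarrow> nat set set \<Rightarrow> nat) \<Rightarrow> (nat \<Rightarrow> real) \<Rightarrow> nat \<Rightarrow> com \<Rightarrow> nat poly \<Rightarrow> bool" where
  "approximates cost \<alpha> d c p \<longleftrightarrow>
     (\<forall>n\<ge>1. \<forall>S. safe_sets {..<n} S \<longrightarrow>
       measure_pmf.prob (pmf_of_set {r :: bool list. length r = poly p n})
         {r. \<exists>t s' r'. exec c (encode n S) r t s' r' \<and>
               output_edges n s' \<in> solutions {..<n} ([{..<n}]\<^bsup>2\<^esup>) S \<and>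
               real (cost {..<n} (output_edges n s'))
                 \<le> \<alpha> n * real (opt cost {..<n} ([{..<n}]\<^bsup>2\<^esup>) S)}
       \<ge> 1 - 1 / real n ^ d)"

definition soft_O :: "(nat \<Rightarrow> real) \<Rightarrow> (nat \<Rightarrow> real) set" where
  "soft_O g = {f. \<exists>k :: nat. f \<in> O(\<lambda>n. g n * ln (real n) ^ k)}"

text \<open>High probability means failure probability at most \<open>1 / n ^ d\<close>, where the exponent \<open>d\<close> is an
  arbitrary constant prescribed in advance.\<close>

definition has_randomized_approximation ::
  "(nat set \<Rightarrow> nat set set \<Rightarrow> nat) \<Rightarrow> (nat \<Rightarrow> real) set \<Rightarrow> bool" where
  "has_randomized_approximation cost A \<longleftrightarrow>
     (\<forall>d. \<exists>\<alpha>\<in>A. \<exists>c p. polynomial_time c p \<and> approximates cost \<alpha> d c p)"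

end

theory Submission
  imports Defs "HOL-Real_Asymp.Real_Asymp"
begin

text \<open>A deterministic greedy algorithm suffices. For a set \<open>F\<close> of chosen edges, let \<open>c(u, v)\<close> be the
  number of components of \<open>F\<close> restricted to \<open>S u v\<close>, and let the potential be the sum of
  \<open>c(u, v) - 1\<close> over the pairs \<open>(u, v)\<close> not yet safely connected. The gain of an edge is the number of
  such pairs in whose safe set it joins two components; choosing it lowers the potential by at
  least the gain.

  Let \<open>E\<close> be an optimal solution and \<open>k = sqrt n\<close>. The fractional edge set with weight \<open>k\<close> on \<open>E\<close> plus
  \<open>1 / k\<close> on all edges has total gain at least the potential: \<open>E\<close> accounts for the pairs with at most
  \<open>k\<close> safe vertices, the complete graph for the others. It costs \<open>O(k)\<close> times the optimum, both in
  total weight and in maximum degree. As the potential is at most \<open>n ^ 3\<close>, always choosing the edge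
  with the best ratio of weight to gain loses only a further logarithmic factor (a harmonic sum).
  For the total number of edges all weights are equal. For the maximum degree the weight of an edge
  \<open>{a, b}\<close> is \<open>2 ^ deg a + 2 ^ deg b\<close>, and the sum of \<open>2 ^ deg v\<close> over all vertices grows by a factor
  of at most \<open>exp (O(k) * opt * gain / potential)\<close> per step.\<close>

section \<open>The greedy algorithm\<close>

text \<open>\<open>L u v w\<close> names the component of \<open>w\<close> in the chosen graph restricted to \<open>S u v\<close>.\<close>

definition useful :: "(nat \<Rightarrow> nat \<Rightarrow> nat set) \<Rightarrow> (nat \<Rightarrow> nat \<Rightarrow> nat \<Rightarrow> nat) \<Rightarrow> nat \<Rightarrow> nat \<Rightarrow> nat \<Rightarrow> nat \<Rightarrow> bool" where
  "useful S L a b u v \<longleftrightarrow> L u v u \<noteq> L u v v \<and> a \<in> S u v \<and> b \<in> S u v \<and> L u v a \<noteq> L u v b"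

definition gain :: "nat \<Rightarrow> (nat \<Rightarrow> nat \<Rightarrow> nat set) \<Rightarrow> (nat \<Rightarrow> nat \<Rightarrow> nat \<Rightarrow> nat) \<Rightarrow> nat \<Rightarrow> nat \<Rightarrow> nat" where
  "gain n S L a b = (\<Sum>u<n. \<Sum>v<n. of_bool (useful S L a b u v))"

definition excess :: "(nat \<Rightarrow> nat \<Rightarrow> nat set) \<Rightarrow> (nat \<Rightarrow> nat \<Rightarrow> nat \<Rightarrow> nat) \<Rightarrow> nat \<Rightarrow> nat \<Rightarrow> nat" where
  "excess S L u v = (if L u v u = L u v v then 0 else card (L u v ` S u v) - 1)"

definition potential :: "nat \<Rightarrow> (nat \<Rightarrow> nat \<Rightarrow> nat set) \<Rightarrow> (nat \<Rightarrow> nat \<Rightarrow> nat \<Rightarrow> nat) \<Rightarrow> nat" where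
  "potential n S L = (\<Sum>u<n. \<Sum>v<n. excess S L u v)"

text \<open>The class of \<open>a\<close> takes over the label of \<open>b\<close>. Pairs that are
  already connected are relabelled too, so the labels keep describing components of the whole chosen
  graph.\<close>

definition relabel ::
  "(nat \<Rightarrow> nat \<Rightarrow> nat set) \<Rightarrow> nat \<Rightarrow> nat \<Rightarrow> (nat \<Rightarrow> nat \<Rightarrow> nat \<Rightarrow> nat) \<Rightarrow> nat \<Rightarrow> nat \<Rightarrow> nat \<Rightarrow> nat" where
  "relabel S a b L u v w =
     (if a \<in> S u v \<and> b \<in> S u v \<and> L u v w = L u v a then L u v b else L u v w)"

definition reweigh :: "bool \<Rightarrow> nat \<Rightarrow> nat \<Rightarrow> (nat \<Rightarrow> nat) \<Rightarrow> nat \<Rightarrow> nat" where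
  "reweigh d a b W x = (if d \<and> (x = a \<or> x = b) then 2 * W x else W x)"

text \<open>\<open>d\<close> selects the objective: with \<open>d\<close>, \<open>W v\<close> is \<open>2\<close> to the degree of \<open>v\<close>; without, \<open>W\<close> stays \<open>1\<close>.\<close>

inductive greedy ::
  "nat \<Rightarrow> (nat \<Rightarrow> nat \<Rightarrow> nat set) \<Rightarrow> bool \<Rightarrow>
    nat set set \<Rightarrow> (nat \<Rightarrow> nat \<Rightarrow> nat \<Rightarrow> nat) \<Rightarrow> (nat \<Rightarrow> nat) \<Rightarrow> bool" for n S d where
  init: "greedy n S d {} (\<lambda>u v w. w) (\<lambda>v. 1)"
| step: "greedy n S d F L W \<Longrightarrow> a < n \<Longrightarrow> b < n \<Longrightarrow> 0 < gain n S L a b \<Longrightarrow>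
    (\<And>a' b'. a' < n \<Longrightarrow> b' < n \<Longrightarrow>
       (W a + W b) * gain n S L a' b' \<le> (W a' + W b') * gain n S L a b) \<Longrightarrow>
    greedy n S d (insert {a, b} F) (relabel S a b L) (reweigh d a b W)"

section \<open>Progress of the potential\<close>

lemma gain_pos_neq:
  assumes "0 < gain n S L a b"
  shows "a \<noteq> b"
proof
  assume "a = b"
  then have "gain n S L a b = 0" by (simp add: gain_def useful_def)
  then show False using assms by simp
qed

lemma safe_setsD:
  assumes "safe_sets {..<n :: nat} S" "u < n" "v < n"
  shows "S u v \<subseteq> {..<n}" "u \<in> S u v" "v \<in> S u v" "finite (S u v)"
proof -
  have "S u v \<subseteq> {..<n} \<and> u \<in> S u v \<and> v \<in> S u v"
    using assms unfolding safe_sets_def by blast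
  then show "S u v \<subseteq> {..<n}" "u \<in> S u v" "v \<in> S u v" "finite (S u v)"
    using finite_subset[of "S u v" "{..<n}"] by simp_all
qed

text \<open>A useful edge deletes exactly one label, \<open>L u v a\<close>, from the image of the
  safe set. If this also connects \<open>u\<close> with \<open>v\<close>, the excess falls to 0;
  that is still a drop of at least one, because \<open>u\<close> and \<open>v\<close> had two
  distinct labels before.\<close>

lemma excess_relabel:
  assumes S: "safe_sets {..<n} S" "u < n" "v < n"
  shows "excess S (relabel S a b L) u v + of_bool (useful S L a b u v) \<le> excess S L u v"
proof (cases "useful S L a b u v")
  case False
  then show ?thesis
  proof (cases "L u v u = L u v v \<or> \<not> (a \<in> S u v \<and> b \<in> S u v)")
    case True
    then show ?thesis using False by (auto simp: excess_def relabel_def)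
  next
    case F2: False
    then have "L u v a = L u v b" using False by (auto simp: useful_def)
    then have "relabel S a b L u v = L u v" by (auto simp: relabel_def fun_eq_iff)
    then show ?thesis using False by (simp add: excess_def)
  qed
next
  case True
  note SD = safe_setsD[OF S]
  have ab: "a \<in> S u v" "b \<in> S u v" "L u v a \<noteq> L u v b" "L u v u \<noteq> L u v v"
    using True by (auto simp: useful_def)
  have im: "relabel S a b L u v ` S u v = L u v ` S u v - {L u v a}"
    using ab by (auto simp: relabel_def image_iff)
  have c: "card (relabel S a b L u v ` S u v) = card (L u v ` S u v) - 1"
    using ab SD unfolding im by (subst card_Diff_singleton) auto
  have "card {L u v u, L u v v} \<le> card (L u v ` S u v)"
    using SD by (intro card_mono) auto
  then show ?thesis using ab True c by (auto simp: excess_def)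
qed

text \<open>Only an inequality: once an edge connects a pair, the remaining excess of that pair
  vanishes at once.\<close>

lemma potential_relabel:
  assumes "safe_sets {..<n} S"
  shows "potential n S (relabel S a b L) + gain n S L a b \<le> potential n S L"
  unfolding potential_def gain_def sum.distrib[symmetric]
  by (intro sum_mono excess_relabel[OF assms]) auto

lemma potential_le:
  assumes "safe_sets {..<n} S"
  shows "potential n S L \<le> n ^ 3"
proof -
  have "excess S L u v \<le> n" if "u < n" "v < n" for u v
  proof -
    have "card (L u v ` S u v) \<le> card {..<n}"
      using safe_setsD[OF assms that] by (meson card_image_le card_mono finite_lessThan le_trans)
    then show ?thesis by (auto simp: excess_def)
  qed
  then have "potential n S L \<le> (\<Sum>u<n. \<Sum>v<n. n)"
    unfolding potential_def by (intro sum_mono) auto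
  then show ?thesis by (simp add: power3_eq_cube)
qed

lemma gain_le: "gain n S L a b \<le> n * n"
proof -
  have "gain n S L a b \<le> (\<Sum>u<n. \<Sum>v<n. 1)"
    unfolding gain_def by (intro sum_mono) auto
  then show ?thesis by simp
qed

lemma greedy_weight_pos: "greedy n S d F L W \<Longrightarrow> 0 < W x"
  by (induction rule: greedy.induct) (auto simp: reweigh_def)

lemma greedy_edges: "greedy n S d F L W \<Longrightarrow> F \<subseteq> [{..<n}]\<^bsup>2\<^esup>"
proof (induction rule: greedy.induct)
  case (step F L W a b)
  then show ?case using gain_pos_neq[OF step(4)] by (auto simp: nsets_def)
qed simp

section \<open>Labels and connectivity\<close>

lemma rtrancl_imp_path:
  assumes "(u, v) \<in> {(x, y). {x, y} \<in> F \<and> x \<in> A \<and> y \<in> A}\<^sup>*" "u \<in> A"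
  shows "\<exists>p. is_path F u p v \<and> set p \<subseteq> A"
  using assms(1)
proof (induction rule: rtrancl_induct)
  case base
  then show ?case using assms(2) by (intro exI[of _ "[u]"]) (auto simp: is_path_def)
next
  case (step y z)
  then obtain p where p: "is_path F u p y" "set p \<subseteq> A" by blast
  show ?case
  proof (cases "z \<in> set p")
    case False
    with p step.hyps(2) show ?thesis
      by (intro exI[of _ "p @ [z]"])
        (auto simp: is_path_def successively_append_iff)
  next
    case True
    \<comment> \<open>The paths of \<open>is_path\<close> are simple, so a step back to a visited
      vertex cuts the path off there instead of extending it.\<close>
    then obtain p1 p2 where q: "p = p1 @ z # p2" by (meson split_list)
    have "is_path F u (p1 @ [z]) z"
      using p(1) unfolding is_path_def q
      by (auto simp: successively_append_iff hd_append split: if_splits)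
    with p q show ?thesis by (intro exI[of _ "p1 @ [z]"]) auto
  qed
qed

text \<open>Two classes are merged only if both \<open>a\<close> and \<open>b\<close> lie in the
  safe set; the new edge then bridges them without leaving it.\<close>

lemma greedy_labels_connected:
  assumes "greedy n S d F L W" "w \<in> S u v" "w' \<in> S u v" "L u v w = L u v w'"
  shows "(w, w') \<in> {(x, y). {x, y} \<in> F \<and> x \<in> S u v \<and> y \<in> S u v}\<^sup>*"
  using assms
proof (induction arbitrary: w w' rule: greedy.induct)
  case init
  then show ?case by simp
next
  case (step F L W a b)
  let ?R = "\<lambda>F. {(x, y). {x, y} \<in> F \<and> x \<in> S u v \<and> y \<in> S u v}"
  have mono: "(x, y) \<in> (?R F)\<^sup>* \<Longrightarrow> (x, y) \<in> (?R (insert {a, b} F))\<^sup>*" for x y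
    by (rule set_mp[OF rtrancl_mono]) auto
  have old: "(x, y) \<in> (?R (insert {a, b} F))\<^sup>*"
    if "x \<in> S u v" "y \<in> S u v" "L u v x = L u v y" for x y
    using step.IH[OF that] mono by blast
  have ab: "(a, b) \<in> (?R (insert {a, b} F))\<^sup>*" "(b, a) \<in> (?R (insert {a, b} F))\<^sup>*"
    if "a \<in> S u v" "b \<in> S u v"
    using that by (auto intro!: r_into_rtrancl simp: insert_commute)
  show ?case
  proof (cases "a \<in> S u v \<and> b \<in> S u v")
    case False
    then show ?thesis using old step.prems by (auto simp: relabel_def)
  next
    case True
    then have T: "a \<in> S u v" "b \<in> S u v" by auto
    consider "L u v w = L u v w'" | "L u v w = L u v a" "L u v w' = L u v b"
      | "L u v w = L u v b" "L u v w' = L u v a"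
      using step.prems True by (auto simp: relabel_def split: if_splits)
    then show ?thesis
    proof cases
      case 1
      then show ?thesis using old step.prems by blast
    next
      case 2
      then show ?thesis using old[of w a] old[of b w'] ab step.prems T
        by (metis (no_types, lifting) rtrancl_trans)
    next
      case 3
      then show ?thesis using old[of w b] old[of a w'] ab step.prems T
        by (metis (no_types, lifting) rtrancl_trans)
    qed
  qed
qed

text \<open>On a complete graph the edge \<open>{u, v}\<close> is itself a candidate, and it would
  be useful for \<open>(u, v)\<close> as long as that pair is separated. Hence absence of gain means
  that every pair is connected.\<close>

lemma greedy_solution:
  assumes "safe_sets {..<n} S" "greedy n S d F L W"
    and no_gain: "\<And>a b. a < n \<Longrightarrow> b < n \<Longrightarrow> gain n S L a b = 0"
  shows "F \<in> solutions {..<n} ([{..<n}]\<^bsup>2\<^esup>) S"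
  unfolding solutions_def safely_connected_def
proof (intro CollectI conjI ballI)
  show "F \<subseteq> [{..<n}]\<^bsup>2\<^esup>" by (rule greedy_edges[OF assms(2)])
next
  fix u v assume "u \<in> {..<n}" "v \<in> {..<n}"
  then have uv: "u < n" "v < n" by auto
  note SD = safe_setsD[OF assms(1) uv]
  have "\<not> useful S L u v u v" using no_gain[OF uv] uv by (auto simp: gain_def)
  then have "L u v u = L u v v" using SD by (auto simp: useful_def)
  then show "\<exists>p. is_path F u p v \<and> set p \<subseteq> S u v"
    using rtrancl_imp_path[OF greedy_labels_connected[OF assms(2)]] SD by blast
qed

section \<open>Crossing edges and degrees\<close>

lemma path_crosses:
  assumes "is_path F u p v" "f u \<noteq> f v"
  shows "\<exists>a b. {a, b} \<in> F \<and> a \<in> set p \<and> b \<in> set p \<and> f a \<noteq> f b"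
proof -
  have "f (hd p) = f (last p)" if "p \<noteq> []" "successively (\<lambda>x y. {x, y} \<in> F) p"
    "\<forall>a\<in>set p. \<forall>b\<in>set p. {a, b} \<in> F \<longrightarrow> f a = f b"
    using that
  proof (induction p rule: induct_list012)
    case (3 x y zs)
    then have "f x = f y" by simp
    moreover have "f (hd (y # zs)) = f (last (y # zs))"
      using 3(4,5) by (intro 3(2)) simp_all
    ultimately show ?case by simp
  qed simp_all
  then show ?thesis using assms unfolding is_path_def by blast
qed

text \<open>The degree as a sum of edge indicators, the form in which it appears when the fractional
  weights at a vertex are added up.\<close>

lemma vertex_degree_eq:
  assumes "E \<subseteq> [{..<n :: nat}]\<^bsup>2\<^esup>" "a < n"
  shows "vertex_degree E a = (\<Sum>b<n. of_bool ({a, b} \<in> E))"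
proof -
  have "bij_betw (\<lambda>b. {a, b}) {b \<in> {..<n}. {a, b} \<in> E} {e \<in> E. a \<in> e}"
    unfolding bij_betw_def
  proof (intro conjI set_eqI iffI)
    show "inj_on (\<lambda>b. {a, b}) {b \<in> {..<n}. {a, b} \<in> E}"
      by (auto simp: inj_on_def doubleton_eq_iff)
  next
    fix e assume e: "e \<in> {e \<in> E. a \<in> e}"
    then have "e \<subseteq> {..<n}" "card e = 2" using assms by (auto simp: nsets_def)
    with e obtain b where "e = {a, b}" "b < n"
      by (auto simp: card_2_iff doubleton_eq_iff)
    with e show "e \<in> (\<lambda>b. {a, b}) ` {b \<in> {..<n}. {a, b} \<in> E}" by auto
  qed auto
  then have "card {b \<in> {..<n}. {a, b} \<in> E} = vertex_degree E a"
    unfolding vertex_degree_def by (rule bij_betw_same_card)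
  moreover have "{b \<in> {..<n}. {a, b} \<in> E} = {..<n} \<inter> {b. {a, b} \<in> E}" by auto
  ultimately show ?thesis using sum_of_bool_eq[of "{..<n}" "\<lambda>b. {a, b} \<in> E", where ?'a = nat] by simp
qed

lemma handshake:
  assumes "E \<subseteq> [{..<n :: nat}]\<^bsup>2\<^esup>"
  shows "(\<Sum>a<n. vertex_degree E a) = 2 * card E"
proof -
  have fin: "finite E" using assms finite_imp_finite_nsets[of "{..<n}" 2] finite_subset by blast
  have "(\<Sum>a<n. vertex_degree E a) = (\<Sum>a<n. \<Sum>e\<in>E. of_bool (a \<in> e))"
    using fin by (simp add: vertex_degree_def sum_of_bool_eq Int_def)
  also have "\<dots> = (\<Sum>e\<in>E. \<Sum>a<n. of_bool (a \<in> e))" by (rule sum.swap)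
  also have "\<dots> = (\<Sum>e\<in>E. 2)"
  proof (rule sum.cong)
    fix e assume "e \<in> E"
    then have "e \<subseteq> {..<n}" "card e = 2" using assms by (auto simp: nsets_def)
    then show "(\<Sum>a<n. of_bool (a \<in> e)) = (2::nat)"
      by (simp add: sum_of_bool_eq Int_absorb1)
  qed simp
  finally show ?thesis by simp
qed

text \<open>With a second vertex around, \<open>v\<close> has to reach it. The resulting lower
  bounds on the optimum absorb the contribution of the complete graph to the fractional
  solution.\<close>

lemma vertex_degree_pos:
  assumes "F \<in> solutions {..<n} E S" "finite F" "2 \<le> (n::nat)" "v < n"
  shows "0 < vertex_degree F v"
proof -
  obtain w where w: "w < n" "w \<noteq> v" using assms(3) by (cases "v = 0") (auto intro: that[of 1] that[of 0])
  obtain p where p: "is_path F v p w"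
    using assms w unfolding solutions_def safely_connected_def by blast
  then obtain x q where "p = v # x # q" using w
    by (cases p; cases "tl p") (auto simp: is_path_def)
  then have "{v, x} \<in> F" using p by (auto simp: is_path_def)
  then show ?thesis using assms(2) unfolding vertex_degree_def
    by (subst card_gt_0_iff) auto
qed

section \<open>Approximation guarantee\<close>

text \<open>The fractional edge weights \<open>k [{a, b} \<in> E] + 1 / k\<close> cover the excess of every pair:
  if the safe set has at most \<open>k\<close> vertices, one crossing edge of the solution \<open>E\<close> suffices;
  otherwise each of its more than \<open>k\<close> vertices differs in label from one vertex of every other
  component.\<close>

lemma excess_cover:
  fixes k :: real
  assumes S: "safe_sets {..<n} S" and E: "E \<in> solutions {..<n} ([{..<n}]\<^bsup>2\<^esup>) S"
    and k: "0 < k" and uv: "u < n" "v < n"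
  shows "real (excess S L u v) \<le>
    (\<Sum>a<n. \<Sum>b<n. (k * of_bool ({a, b} \<in> E) + 1 / k) * of_bool (useful S L a b u v))"
    (is "_ \<le> ?rhs")
proof (cases "L u v u = L u v v")
  case True
  then show ?thesis using k by (auto simp: excess_def intro!: sum_nonneg)
next
  case sep: False
  note SD = safe_setsD[OF S uv]
  let ?l = "L u v" and ?A = "S u v"
  have crd: "card (?l ` ?A) \<le> card ?A" using SD by (simp add: card_image_le)
  have ex: "excess S L u v = card (?l ` ?A) - 1" using sep by (simp add: excess_def)
  show ?thesis
  proof (cases "real (card ?A) \<le> k")
    case True
    obtain p where p: "is_path E u p v" "set p \<subseteq> ?A"
      using E uv unfolding solutions_def safely_connected_def by blast
    from path_crosses[OF p(1), of ?l] sep obtain a b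
      where ab: "{a, b} \<in> E" "a \<in> set p" "b \<in> set p" "?l a \<noteq> ?l b" by blast
    have abn: "a < n" "b < n" using ab p SD by auto
    have us: "useful S L a b u v" using ab p sep by (auto simp: useful_def)
    let ?f = "\<lambda>a b. (k * of_bool ({a, b} \<in> E) + 1 / k) * of_bool (useful S L a b u v)"
    have nn: "0 \<le> ?f a b" for a b using k by auto
    have "real (excess S L u v) \<le> k" using True crd ex by linarith
    also have "\<dots> \<le> ?f a b" using us ab k by simp
    also have "\<dots> \<le> (\<Sum>b<n. ?f a b)"
      using member_le_sum[of b "{..<n}" "?f a"] nn abn by blast
    also have "\<dots> \<le> ?rhs"
      using abn nn by (intro member_le_sum[where f = "\<lambda>a. \<Sum>b<n. ?f a b"] sum_nonneg) auto
    finally show ?thesis .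
  next
    case False
    have row: "card (?l ` ?A) - 1 \<le> (\<Sum>b<n. of_bool (useful S L a b u v))" if a: "a \<in> ?A" for a
    proof -
      have "card (?l ` ?A - {?l a}) \<le> card {b \<in> ?A. ?l b \<noteq> ?l a}"
        using SD(4) by (intro surj_card_le[where f = ?l]) auto
      moreover have "card (?l ` ?A - {?l a}) = card (?l ` ?A) - 1" using a by simp
      moreover have "{b \<in> ?A. ?l b \<noteq> ?l a} = {..<n} \<inter> {b. useful S L a b u v}"
        using SD a sep by (auto simp: useful_def)
      ultimately show ?thesis by (simp add: sum_of_bool_eq)
    qed
    have "k * (card (?l ` ?A) - 1) \<le> real (card ?A) * (card (?l ` ?A) - 1)"
      using False by (intro mult_right_mono) auto
    also have "\<dots> = real (\<Sum>a\<in>?A. card (?l ` ?A) - 1)" by simp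
    also have "\<dots> \<le> real (\<Sum>a\<in>?A. \<Sum>b<n. of_bool (useful S L a b u v))"
      by (intro of_nat_mono sum_mono row)
    also have "\<dots> \<le> real (\<Sum>a<n. \<Sum>b<n. of_bool (useful S L a b u v))"
      using SD by (intro of_nat_mono sum_mono2) auto
    finally have "real (excess S L u v) \<le> (1 / k) * (\<Sum>a<n. \<Sum>b<n. of_bool (useful S L a b u v))"
      using k ex by (simp add: field_simps)
    also have "\<dots> = (\<Sum>a<n. \<Sum>b<n. (1 / k) * of_bool (useful S L a b u v))"
      by (simp only: sum_distrib_left of_nat_sum of_nat_of_bool)
    also have "\<dots> \<le> ?rhs"
      using k by (intro sum_mono mult_right_mono) auto
    finally show ?thesis .
  qed
qed

text \<open>Summing the cover over all pairs and exchanging the summations collects the indicators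
  of \<open>useful\<close> into the gain of each edge.\<close>

lemma potential_cover:
  fixes k :: real
  assumes S: "safe_sets {..<n} S" and E: "E \<in> solutions {..<n} ([{..<n}]\<^bsup>2\<^esup>) S" and k: "0 < k"
  shows "real (potential n S L) \<le>
    (\<Sum>a<n. \<Sum>b<n. (k * of_bool ({a, b} \<in> E) + 1 / k) * real (gain n S L a b))"
proof -
  let ?x = "\<lambda>a b. k * of_bool ({a, b} \<in> E) + 1 / k"
  have "real (potential n S L) \<le>
    (\<Sum>u<n. \<Sum>v<n. \<Sum>a<n. \<Sum>b<n. ?x a b * of_bool (useful S L a b u v))"
    unfolding potential_def of_nat_sum by (intro sum_mono excess_cover assms) auto
  also have "\<dots> = (\<Sum>u<n. \<Sum>a<n. \<Sum>v<n. \<Sum>b<n. ?x a b * of_bool (useful S L a b u v))"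
    by (intro sum.cong refl sum.swap)
  also have "\<dots> = (\<Sum>a<n. \<Sum>u<n. \<Sum>v<n. \<Sum>b<n. ?x a b * of_bool (useful S L a b u v))"
    by (rule sum.swap)
  also have "\<dots> = (\<Sum>a<n. \<Sum>u<n. \<Sum>b<n. \<Sum>v<n. ?x a b * of_bool (useful S L a b u v))"
    by (intro sum.cong refl sum.swap)
  also have "\<dots> = (\<Sum>a<n. \<Sum>b<n. \<Sum>u<n. \<Sum>v<n. ?x a b * of_bool (useful S L a b u v))"
    by (intro sum.cong refl sum.swap)
  also have "\<dots> = (\<Sum>a<n. \<Sum>b<n. ?x a b * real (gain n S L a b))"
    by (simp only: gain_def of_nat_sum sum_distrib_left of_nat_of_bool)
  finally show ?thesis .
qed

text \<open>An averaging argument: the fractional edge set gains at least the potential, so the edge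
  with the best ratio of weight to gain is no worse than total fractional weight over potential.
  Applying \<open>best\<close> termwise expresses this without division. The factor 2 arises because
  each of the two endpoint weights contributes the same sum over ordered pairs.\<close>

lemma greedy_choice:
  fixes W :: "nat \<Rightarrow> nat"
  assumes S: "safe_sets {..<n} S" and E: "E \<in> solutions {..<n} ([{..<n}]\<^bsup>2\<^esup>) S" and n: "0 < n"
    and best: "\<And>a' b'. a' < n \<Longrightarrow> b' < n \<Longrightarrow>
       (W a + W b) * gain n S L a' b' \<le> (W a' + W b') * gain n S L a b"
  shows "real (W a + W b) * real (potential n S L) \<le>
    real (gain n S L a b) * (2 * sqrt n * (\<Sum>v<n. real (vertex_degree E v + 1) * real (W v)))"
proof -
  let ?k = "sqrt (real n)"
  let ?x = "\<lambda>a b. ?k * of_bool ({a, b} \<in> E) + 1 / ?k"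
  have k: "0 < ?k" using n by simp
  have En: "E \<subseteq> [{..<n}]\<^bsup>2\<^esup>" using E by (auto simp: solutions_def)
  \<comment> \<open>This balance dictates \<open>k = sqrt n\<close>: at a vertex the complete graph
    contributes \<open>n / k\<close>, the optimum \<open>k\<close> times the degree.\<close>
  have nk: "real n / ?k = ?k" using n by (simp add: real_div_sqrt)
  have half: "(\<Sum>a<n. \<Sum>b<n. ?x a b * real (W a)) =
      ?k * (\<Sum>v<n. real (vertex_degree E v + 1) * real (W v))"
  proof -
    have "(\<Sum>b<n. ?x a b * real (W a)) = ?k * (real (vertex_degree E a + 1) * real (W a))"
      if "a < n" for a
    proof -
      have "(\<Sum>b<n. ?x a b * real (W a)) = (\<Sum>b<n. ?x a b) * real (W a)"
        by (simp add: sum_distrib_right)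
      also have "(\<Sum>b<n. ?x a b) = ?k * real (vertex_degree E a) + real n / ?k"
        using that by (simp add: sum.distrib sum_distrib_left vertex_degree_eq[OF En])
      finally show ?thesis unfolding nk by (simp add: algebra_simps)
    qed
    then show ?thesis by (simp add: sum_distrib_left)
  qed
  have half': "(\<Sum>a<n. \<Sum>b<n. ?x a b * real (W b)) = (\<Sum>a<n. \<Sum>b<n. ?x a b * real (W a))"
    by (subst sum.swap) (simp add: insert_commute)
  have "real (W a + W b) * real (potential n S L) \<le>
      real (W a + W b) * (\<Sum>a'<n. \<Sum>b'<n. ?x a' b' * real (gain n S L a' b'))"
    by (intro mult_left_mono potential_cover[OF S E k]) auto
  also have "\<dots> = (\<Sum>a'<n. \<Sum>b'<n. ?x a' b' * real ((W a + W b) * gain n S L a' b'))"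
    by (simp add: sum_distrib_left mult_ac)
  also have "\<dots> \<le> (\<Sum>a'<n. \<Sum>b'<n. ?x a' b' * real ((W a' + W b') * gain n S L a b))"
    using k by (intro sum_mono mult_left_mono of_nat_mono best) auto
  also have "\<dots> = real (gain n S L a b) *
      ((\<Sum>a'<n. \<Sum>b'<n. ?x a' b' * real (W a')) + (\<Sum>a'<n. \<Sum>b'<n. ?x a' b' * real (W b')))"
    by (simp add: sum_distrib_left sum.distrib[symmetric] algebra_simps)
  also have "\<dots> = real (gain n S L a b) *
      (2 * ?k * (\<Sum>v<n. real (vertex_degree E v + 1) * real (W v)))"
    unfolding half' half by simp
  finally show ?thesis .
qed

section \<open>Charging the steps to a telescoping harmonic sum\<close>

lemma harm_diff_ge:
  assumes "m + g \<le> (M :: nat)" "0 < g"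
  shows "real g / real M \<le> harm M - harm m"
proof -
  have "harm M - harm m = (\<Sum>j\<in>{m<..M}. 1 / real j)"
  proof -
    have "{1..M} = {1..m} \<union> {m<..M}" "{1..m} \<inter> {m<..M} = {}" using assms by auto
    then have "(\<Sum>j\<in>{1..M}. 1 / real j) = (\<Sum>j\<in>{1..m}. 1 / real j) + (\<Sum>j\<in>{m<..M}. 1 / real j)"
      by (simp only: sum.union_disjoint finite_atLeastAtMost finite_greaterThanAtMost)
    then show ?thesis by (simp add: harm_def inverse_eq_divide)
  qed
  \<comment> \<open>Each of the \<open>M - m \<ge> g\<close> terms is at least the last one,
    \<open>1 / M\<close>.\<close>
  also have "\<dots> \<ge> (\<Sum>j\<in>{m<..M}. 1 / real M)"
    using assms by (intro sum_mono divide_left_mono) auto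
  moreover have "(\<Sum>j\<in>{m<..M}. 1 / real M) = real (M - m) / real M" by simp
  moreover have "real g / real M \<le> real (M - m) / real M"
    using assms by (intro divide_right_mono) auto
  ultimately show ?thesis by linarith
qed

lemma harm_cube_le:
  assumes "0 < n" "m \<le> n ^ 3"
  shows "harm m \<le> 1 + 3 * ln (real n)"
proof -
  have "harm m \<le> (harm (n ^ 3) :: real)" using assms(2) by (rule harm_mono)
  also have "\<dots> \<le> 1 + ln (real (n ^ 3))"
    \<comment> \<open>The sequence \<open>harm (Suc i) - ln (Suc i)\<close> decreases from its value
      1 at \<open>i = 0\<close>; the shift by one explains \<open>n ^ 3 - 1\<close>.\<close>
    using decseqD[OF decseq_harm_diff_ln, of 0 "n ^ 3 - 1"] assms(1) by (simp add: harm_expand)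
  finally show ?thesis using assms by (simp add: ln_realpow)
qed

text \<open>A cost \<open>c\<close> of at most \<open>B\<close> times gain over potential is paid
  for by the drop of the harmonic number of the potential. Over a whole run these drops
  telescope.\<close>

lemma greedy_step_harm:
  assumes S: "safe_sets {..<n} S" and g: "0 < gain n S L a b"
    and le: "c * real (potential n S L) \<le> real (gain n S L a b) * B" and B: "0 \<le> B"
  shows "c \<le> B * (harm (potential n S L) - harm (potential n S (relabel S a b L)))"
proof -
  have pos: "0 < potential n S L" using potential_relabel[OF S, of a b L] g by linarith
  have "c \<le> B * (real (gain n S L a b) / real (potential n S L))"
    using le pos by (simp add: field_simps)
  also have "\<dots> \<le> B * (harm (potential n S L) - harm (potential n S (relabel S a b L)))"
    by (intro mult_left_mono harm_diff_ge potential_relabel S g B)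
  finally show ?thesis .
qed

text \<open>With unit weights each step adds at most one edge, and the charge of each step is at
  least 1. That \<open>W\<close> stays constant is carried through the same induction.\<close>

lemma greedy_num_edges:
  assumes S: "safe_sets {..<n} S" and E: "E \<in> solutions {..<n} ([{..<n}]\<^bsup>2\<^esup>) S" and n: "2 \<le> n"
    and gr: "greedy n S False F L W"
  shows "real (card F) \<le> 4 * sqrt n * card E *
    (harm (potential n S (\<lambda>u v w. w)) - harm (potential n S L)) \<and> W = (\<lambda>v. 1)"
  using gr
proof (induction rule: greedy.induct)
  case init
  then show ?case by simp
next
  case (step F L W a b)
  then have W: "W = (\<lambda>v. 1)" by blast
  have En: "E \<subseteq> [{..<n}]\<^bsup>2\<^esup>" using E by (auto simp: solutions_def)
  have finE: "finite E" using En finite_imp_finite_nsets[of "{..<n}" 2] finite_subset by blast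
  \<comment> \<open>No vertex is isolated in \<open>E\<close>, so \<open>n\<close> is at most twice
    the number of its edges and the sum of \<open>deg + 1\<close> is at most four times that
    number.\<close>
  have "(\<Sum>v<n. 1) \<le> (\<Sum>v<n. vertex_degree E v)"
    using vertex_degree_pos[OF E finE n] by (intro sum_mono) (auto simp: Suc_le_eq)
  then have nE: "n \<le> 2 * card E" using handshake[OF En] by simp
  have "(\<Sum>v<n. real (vertex_degree E v + 1) * real (W v)) = real (\<Sum>v<n. vertex_degree E v + 1)"
    by (simp add: W)
  also have "(\<Sum>v<n. vertex_degree E v + 1) = 2 * card E + n"
    by (simp only: sum.distrib handshake[OF En]) simp
  finally have total: "(\<Sum>v<n. real (vertex_degree E v + 1) * real (W v)) \<le> 4 * card E"
    using nE by simp
  have "real (W a + W b) * real (potential n S L) \<le>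
    real (gain n S L a b) * (2 * sqrt n * (\<Sum>v<n. real (vertex_degree E v + 1) * real (W v)))"
    using n step.hyps by (intro greedy_choice[OF S E]) auto
  also have "\<dots> \<le> real (gain n S L a b) * (2 * sqrt n * (4 * card E))"
    by (intro mult_left_mono total) auto
  \<comment> \<open>Here \<open>W a + W b = 2\<close> cancels half of the constant 8.\<close>
  finally have "1 * real (potential n S L) \<le> real (gain n S L a b) * (4 * sqrt n * card E)"
    by (simp add: W mult_ac)
  then have "1 \<le> 4 * sqrt n * card E *
      (harm (potential n S L) - harm (potential n S (relabel S a b L)))"
    by (intro greedy_step_harm[OF S]) (use step.hyps in auto)
  moreover have "card (insert {a, b} F) \<le> card F + 1"
    by (cases "finite F") (simp_all add: card_insert_if)
  ultimately have "real (card (insert {a, b} F)) \<le> 4 * sqrt n * card E *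
    (harm (potential n S (\<lambda>u v w. w)) - harm (potential n S (relabel S a b L)))"
    using step.IH by (simp add: algebra_simps)
  then show ?case by (simp add: W reweigh_def)
qed

text \<open>Multiplicative weights: doubling \<open>W a\<close> and \<open>W b\<close> adds their
  old values to the total, a growth by a factor \<open>1 + x \<le> exp x\<close>, where
  \<open>x\<close> is a multiple of the harmonic drop. The product of these factors is an
  exponential of a telescoping sum.\<close>

lemma greedy_weight:
  assumes S: "safe_sets {..<n} S" and E: "E \<in> solutions {..<n} ([{..<n}]\<^bsup>2\<^esup>) S" and n: "2 \<le> n"
    and D: "\<And>v. v < n \<Longrightarrow> vertex_degree E v \<le> D"
    and gr: "greedy n S True F L W"
  shows "(\<Sum>v<n. real (W v)) \<le> real n * exp (4 * sqrt n * D *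
    (harm (potential n S (\<lambda>u v w. w)) - harm (potential n S L)))"
  using gr
proof (induction rule: greedy.induct)
  case init
  then show ?case by simp
next
  case (step F L W a b)
  let ?h = "\<lambda>L. harm (potential n S L) :: real"
  define \<Psi> where "\<Psi> = (\<Sum>v<n. real (W v))"
  have finE: "finite E"
    using E finite_imp_finite_nsets[of "{..<n}" 2] finite_subset by (auto simp: solutions_def)
  \<comment> \<open>This allows \<open>deg + 1\<close> to be bounded by
    \<open>2 * D\<close>.\<close>
  have "1 \<le> D" using vertex_degree_pos[OF E finE n, of 0] D[of 0] n by simp
  then have D2: "vertex_degree E v + 1 \<le> 2 * D" if "v < n" for v using D[OF that] by simp
  have ab: "a \<noteq> b" by (rule gain_pos_neq) fact
  have "0 < \<Psi>" unfolding \<Psi>_def using n greedy_weight_pos[OF step.hyps(1)] by (intro sum_pos) (auto simp: lessThan_empty_iff)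
  have "(\<Sum>v<n. real (vertex_degree E v + 1) * real (W v)) \<le> (\<Sum>v<n. real (2 * D) * real (W v))"
    by (intro sum_mono mult_right_mono of_nat_mono D2) auto
  also have "\<dots> = 2 * D * \<Psi>" by (simp add: \<Psi>_def sum_distrib_left)
  finally have total: "(\<Sum>v<n. real (vertex_degree E v + 1) * real (W v)) \<le> 2 * D * \<Psi>" .
  have "real (W a + W b) * real (potential n S L) \<le>
    real (gain n S L a b) * (2 * sqrt n * (\<Sum>v<n. real (vertex_degree E v + 1) * real (W v)))"
    using n step.hyps by (intro greedy_choice[OF S E]) auto
  also have "\<dots> \<le> real (gain n S L a b) * (2 * sqrt n * (2 * D * \<Psi>))"
    by (intro mult_left_mono total) auto
  finally have "real (W a + W b) \<le> 2 * sqrt n * (2 * D * \<Psi>) * (?h L - ?h (relabel S a b L))"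
    using \<open>0 < \<Psi>\<close> by (intro greedy_step_harm[OF S]) (use step.hyps in auto)
  then have inc: "real (W a + W b) \<le> \<Psi> * (4 * sqrt n * D * (?h L - ?h (relabel S a b L)))"
    by (simp add: mult_ac)
  have "(\<Sum>v<n. real (reweigh True a b W v)) =
      (\<Sum>v<n. real (W v) + (if v = a then real (W a) else 0) + (if v = b then real (W b) else 0))"
    using ab by (intro sum.cong) (auto simp: reweigh_def)
  also have "\<dots> = \<Psi> + real (W a + W b)"
    using step.hyps by (simp add: sum.distrib \<Psi>_def)
  also have "\<dots> \<le> \<Psi> * (1 + 4 * sqrt n * D * (?h L - ?h (relabel S a b L)))"
    using inc by (simp add: distrib_left)
  also have "\<dots> \<le> \<Psi> * exp (4 * sqrt n * D * (?h L - ?h (relabel S a b L)))"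
    using \<open>0 < \<Psi>\<close> by (intro mult_left_mono exp_ge_add_one_self) auto
  also have "\<dots> \<le> real n * exp (4 * sqrt n * D * (?h (\<lambda>u v w. w) - ?h L)) *
      exp (4 * sqrt n * D * (?h L - ?h (relabel S a b L)))"
    using step.IH by (intro mult_right_mono) (auto simp: \<Psi>_def)
  also have "\<dots> = real n * exp (4 * sqrt n * D * (?h (\<lambda>u v w. w) - ?h (relabel S a b L)))"
    by (simp add: mult.assoc exp_add[symmetric] algebra_simps)
  finally show ?case .
qed

text \<open>The inequality also covers an edge that is already in \<open>F\<close>: reinserting it
  doubles the weight but leaves the degree alone.\<close>

lemma greedy_degree_weight:
  assumes "greedy n S True F L W"
  shows "2 ^ vertex_degree F v \<le> W v"
  using assms
proof (induction rule: greedy.induct)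
  case init
  then show ?case by (simp add: vertex_degree_def)
next
  case (step F L W a b)
  have "finite F"
    using greedy_edges[OF step.hyps(1)] finite_imp_finite_nsets[of "{..<n}" 2] finite_subset by blast
  have deg: "vertex_degree (insert {a, b} F) v \<le> vertex_degree F v + of_bool (v \<in> {a, b})"
  proof (cases "v \<in> {a, b}")
    case True
    then have "{e \<in> insert {a, b} F. v \<in> e} = insert {a, b} {e \<in> F. v \<in> e}" by auto
    then show ?thesis
      using True \<open>finite F\<close> unfolding vertex_degree_def by (simp add: card_insert_if)
  next
    case False
    then have "{e \<in> insert {a, b} F. v \<in> e} = {e \<in> F. v \<in> e}" by auto
    then show ?thesis by (simp add: vertex_degree_def)
  qed
  have "(2::nat) ^ vertex_degree (insert {a, b} F) v \<le> 2 ^ (vertex_degree F v + of_bool (v \<in> {a, b}))"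
    using deg by (intro power_increasing) auto
  also have "\<dots> \<le> reweigh True a b W v"
    using step.IH by (auto simp: reweigh_def)
  finally show ?case .
qed

text \<open>A common ratio for both objectives. The term \<open>1 + 3 * ln n\<close> bounds the
  harmonic number of \<open>n ^ 3\<close>; the summand \<open>ln n\<close> and the division by
  \<open>ln 2\<close> come from taking the binary logarithm of \<open>n * exp (...)\<close> in the
  degree bound.\<close>

definition factor :: "nat \<Rightarrow> real" where
  "factor n = (ln n + 4 * sqrt n * (1 + 3 * ln n)) / ln 2"

lemma greedy_approximates_edges:
  assumes S: "safe_sets {..<n} S" and E: "E \<in> solutions {..<n} ([{..<n}]\<^bsup>2\<^esup>) S" and n: "1 \<le> n"
    and gr: "greedy n S False F L W"
  shows "real (num_edges {..<n} F) \<le> factor n * num_edges {..<n} E"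
proof (cases "n = 1")
  case True
  then have "[{..<n}]\<^bsup>2\<^esup> = {}" by (simp add: nsets_eq_empty)
  then show ?thesis using greedy_edges[OF gr] E by (simp add: num_edges_def solutions_def)
next
  case False
  then have n2: "2 \<le> n" using n by simp
  have h: "harm (potential n S (\<lambda>u v w. w)) - harm (potential n S L) \<le> 1 + 3 * ln (real n)"
    using harm_cube_le[OF _ potential_le[OF S]] harm_nonneg[of "potential n S L"] n
    by (smt (verit) less_eq_Suc_le One_nat_def)
  have "real (card F) \<le> 4 * sqrt n * card E * (1 + 3 * ln (real n))"
    using greedy_num_edges[OF S E n2 gr] mult_left_mono[OF h, of "4 * sqrt n * card E"] by simp
  also have "\<dots> = (4 * sqrt n * (1 + 3 * ln (real n))) * card E" by simp
  also have "\<dots> \<le> factor n * card E"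
  proof (intro mult_right_mono)
    \<comment> \<open>Adding \<open>ln n \<ge> 0\<close> and dividing by \<open>ln 2 \<le> 1\<close>
      only enlarges the ratio.\<close>
    have l2: "0 < ln (2::real)" "ln (2::real) \<le> 1" using ln_2_less_1 by auto
    have pos: "0 \<le> ln n" "0 \<le> 4 * sqrt n * (1 + 3 * ln n)" using n by auto
    have "4 * sqrt n * (1 + 3 * ln n) * ln 2 \<le> 4 * sqrt n * (1 + 3 * ln n) * 1"
      using l2 pos by (intro mult_left_mono) auto
    then show "4 * sqrt n * (1 + 3 * ln n) \<le> factor n"
      unfolding factor_def using l2 pos by (simp add: pos_le_divide_eq)
  qed simp
  finally show ?thesis by (simp add: num_edges_def)
qed

text \<open>Any single weight is at most the total weight, so logarithms turn the exponential bound
  on the total into a bound on each degree.\<close>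

lemma greedy_approximates_degree:
  assumes S: "safe_sets {..<n} S" and E: "E \<in> solutions {..<n} ([{..<n}]\<^bsup>2\<^esup>) S" and n: "1 \<le> n"
    and gr: "greedy n S True F L W"
  shows "real (max_degree {..<n} F) \<le> factor n * max_degree {..<n} E"
proof (cases "n = 1")
  case True
  then have "[{..<n}]\<^bsup>2\<^esup> = {}" by (simp add: nsets_eq_empty)
  then have "F = {}" "E = {}" using greedy_edges[OF gr] E by (auto simp: solutions_def)
  then show ?thesis using True by (simp add: max_degree_def vertex_degree_def lessThan_Suc)
next
  case False
  then have n2: "2 \<le> n" using n by simp
  define D where "D = max_degree {..<n} E"
  have D: "vertex_degree E v \<le> D" if "v < n" for v
    unfolding D_def max_degree_def using that by (intro Max_ge) auto
  have finE: "finite E"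
    using E finite_imp_finite_nsets[of "{..<n}" 2] finite_subset by (auto simp: solutions_def)
  have "1 \<le> D" using vertex_degree_pos[OF E finE n2, of 0] D[of 0] n by simp
  have h: "harm (potential n S (\<lambda>u v w. w)) - harm (potential n S L) \<le> 1 + 3 * ln (real n)"
    using harm_cube_le[OF _ potential_le[OF S]] harm_nonneg[of "potential n S L"] n
    by (smt (verit) less_eq_Suc_le One_nat_def)
  have deg: "real (vertex_degree F v) \<le> factor n * D" if v: "v < n" for v
  proof -
    have "real (2 ^ vertex_degree F v) \<le> real (W v)"
      using greedy_degree_weight[OF gr, of v] by (rule of_nat_mono)
    also have "\<dots> \<le> (\<Sum>v<n. real (W v))" using v by (intro member_le_sum) auto
    also have "\<dots> \<le> real n * exp (4 * sqrt n * D *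
        (harm (potential n S (\<lambda>u v w. w)) - harm (potential n S L)))"
      by (rule greedy_weight[OF S E n2 D gr])
    also have "\<dots> \<le> real n * exp (4 * sqrt n * D * (1 + 3 * ln (real n)))"
      using h by (intro mult_left_mono) (auto intro!: mult_left_mono)
    finally have "ln (2 ^ vertex_degree F v) \<le> ln (real n * exp (4 * sqrt n * D * (1 + 3 * ln (real n))))"
      using n by (subst ln_le_cancel_iff) auto
    then have "real (vertex_degree F v) * ln 2 \<le> ln n + 4 * sqrt n * (1 + 3 * ln n) * D"
      using n by (simp add: ln_mult ln_realpow mult_ac)
    \<comment> \<open>The optimum \<open>D\<close> is at least 1, so the additive
      \<open>ln n\<close> becomes part of the ratio.\<close>
    also have "\<dots> \<le> ln n * D + 4 * sqrt n * (1 + 3 * ln n) * D"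
      using \<open>1 \<le> D\<close> n by (simp add: mult_le_cancel_left1)
    also have "\<dots> = factor n * D * ln 2" by (simp add: factor_def distrib_right[symmetric] del: distrib_right_numeral)
    finally show ?thesis by simp
  qed
  have "max_degree {..<n} F \<in> vertex_degree F ` {..<n}"
    unfolding max_degree_def using n by (intro Max_in) (auto simp: lessThan_empty_iff)
  then show ?thesis using deg by (auto simp: D_def)
qed

lemma factor_soft_O: "factor \<in> soft_O (\<lambda>n. sqrt (real n))"
  unfolding soft_O_def factor_def
  by (rule CollectI, rule exI[of _ 1]) real_asymp

section \<open>Total correctness with running times\<close>

text \<open>One time and one final memory serve every tape \<open>r\<close>, which is handed back
  unread: total correctness for runs without coin tosses. The start memory comes last, so that
  \<open>runs\<close> can itself be a postcondition.\<close>

definition runs :: "nat \<Rightarrow> com \<Rightarrow> (state \<Rightarrow> bool) \<Rightarrow> state \<Rightarrow> bool" where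
  "runs T c Q s \<longleftrightarrow> (\<exists>t s'. t \<le> T \<and> (\<forall>r. exec c s r t s' r) \<and> Q s')"

primrec writes :: "com \<Rightarrow> vname set" where
  "writes Skip = {}"
| "writes (Assign x i a) = {x}"
| "writes (Toss x i) = {x}"
| "writes (Seq c1 c2) = writes c1 \<union> writes c2"
| "writes (Cond b c1 c2) = writes c1 \<union> writes c2"
| "writes (While b c) = writes c"

definition eq_outside :: "vname set \<Rightarrow> state \<Rightarrow> state \<Rightarrow> bool" where
  "eq_outside X s s' \<longleftrightarrow> (\<forall>x. x \<notin> X \<longrightarrow> s' x = s x)"

lemma eq_outsideD: "eq_outside X s s' \<Longrightarrow> x \<notin> X \<Longrightarrow> s' x = s x"
  by (simp add: eq_outside_def)

lemma exec_frame: "exec c s r t s' r' \<Longrightarrow> eq_outside (writes c) s s'"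
  by (induction rule: exec.induct) (auto simp: eq_outside_def upd_def)

lemma runs_mono: "runs T c Q s \<Longrightarrow> T \<le> T' \<Longrightarrow> (\<And>s'. Q s' \<Longrightarrow> Q' s') \<Longrightarrow> runs T' c Q' s"
  unfolding runs_def by (meson le_trans)

lemma runs_frame:
  assumes "runs T c Q s"
  shows "runs T c (\<lambda>s'. Q s' \<and> eq_outside (writes c) s s') s"
  using assms exec_frame unfolding runs_def by blast

text \<open>Consequence rule with a built-in frame: specifications of subroutines may be silent
  about the arrays they never write.\<close>

lemma runs_conseq:
  assumes "runs T c Q s" "T \<le> T'" "\<And>s'. Q s' \<Longrightarrow> eq_outside (writes c) s s' \<Longrightarrow> Q' s'"
  shows "runs T' c Q' s"
  using runs_mono[OF runs_frame[OF assms(1)] assms(2)] assms(3) by blast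

lemma runs_Skip: "Q s \<Longrightarrow> 1 \<le> T \<Longrightarrow> runs T Skip Q s"
  unfolding runs_def using exec.Skip by blast

lemma runs_Assign: "Q (upd s x (aval i s) (aval a s)) \<Longrightarrow> 1 \<le> T \<Longrightarrow> runs T (Assign x i a) Q s"
  unfolding runs_def using exec.Assign by blast

lemma runs_Seq:
  assumes "runs T1 c1 (\<lambda>s'. runs T2 c2 Q s') s" "1 + T1 + T2 \<le> T"
  shows "runs T (Seq c1 c2) Q s"
proof -
  from assms(1) obtain t1 s1 t2 s2 where "t1 \<le> T1" "\<forall>r. exec c1 s r t1 s1 r" "t2 \<le> T2"
    "\<forall>r. exec c2 s1 r t2 s2 r" "Q s2"
    unfolding runs_def by blast
  then show ?thesis using assms(2) unfolding runs_def
    by (intro exI[of _ "1 + t1 + t2"] exI[of _ s2]) (auto intro: exec.Seq[simplified])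
qed

lemma runs_Seq_Assign:
  assumes "runs T2 c (\<lambda>s'. Q s') (upd s x (aval i s) (aval a s))" "2 + T2 \<le> T"
  shows "runs T (Seq (Assign x i a) c) Q s"
  by (rule runs_Seq[where ?T1.0 = 1 and ?T2.0 = T2], rule runs_Assign) (use assms in simp_all)

lemma runs_Cond:
  assumes "bval b s \<Longrightarrow> runs T c1 Q s" "\<not> bval b s \<Longrightarrow> runs T c2 Q s" "1 + T \<le> T'"
  shows "runs T' (Cond b c1 c2) Q s"
proof (cases "bval b s")
  case True
  then obtain t s' where "t \<le> T" "\<forall>r. exec c1 s r t s' r" "Q s'"
    using assms(1) unfolding runs_def by blast
  then show ?thesis using True assms(3) unfolding runs_def
    by (intro exI[of _ "1 + t"] exI[of _ s']) (auto intro: exec.CondTrue[simplified])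
next
  case False
  then obtain t s' where "t \<le> T" "\<forall>r. exec c2 s r t s' r" "Q s'"
    using assms(2) unfolding runs_def by blast
  then show ?thesis using False assms(3) unfolding runs_def
    by (intro exI[of _ "1 + t"] exI[of _ s']) (auto intro: exec.CondFalse[simplified])
qed

text \<open>The index \<open>k\<close> of the invariant bounds the number of iterations still to come.\<close>

lemma runs_While:
  assumes "I k s"
    and "\<And>k s. I k s \<Longrightarrow> bval b s \<Longrightarrow> runs T c (\<lambda>s'. \<exists>j<k. I j s') s"
    and "k * (T + 1) + 1 \<le> T'"
  shows "runs T' (While b c) (\<lambda>s'. (\<exists>j. I j s') \<and> \<not> bval b s') s"
proof -
  have "runs (k * (T + 1) + 1) (While b c) (\<lambda>s'. (\<exists>j. I j s') \<and> \<not> bval b s') s"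
    using assms(1)
  proof (induction k arbitrary: s rule: less_induct)
    case (less k)
    show ?case
    proof (cases "bval b s")
      case False
      then show ?thesis using less.prems unfolding runs_def
        by (intro exI[of _ 1] exI[of _ s]) (auto intro: exec.WhileFalse[simplified])
    next
      case True
      from assms(2)[OF less.prems True] obtain t1 s1 j where
        1: "t1 \<le> T" "\<forall>r. exec c s r t1 s1 r" "j < k" "I j s1"
        unfolding runs_def by blast
      from less.IH[OF 1(3,4)] obtain t2 s2 where
        2: "t2 \<le> j * (T + 1) + 1" "\<forall>r. exec (While b c) s1 r t2 s2 r"
          "(\<exists>j. I j s2) \<and> \<not> bval b s2"
        unfolding runs_def by blast
      have "(j + 1) * (T + 1) \<le> k * (T + 1)" using 1(3) by (intro mult_right_mono) auto
      then have "1 + t1 + t2 \<le> k * (T + 1) + 1" using 1(1) 2(1) by (simp add: algebra_simps)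
      then show ?thesis using True 1 2 unfolding runs_def
        by (intro exI[of _ "1 + t1 + t2"] exI[of _ s2]) (auto intro: exec.WhileTrue[simplified])
    qed
  qed
  then show ?thesis using assms(3) by (rule runs_mono)
qed

abbreviation Var :: "vname \<Rightarrow> aexp" where
  "Var x \<equiv> Cell x (Const 0)"

abbreviation Set :: "vname \<Rightarrow> aexp \<Rightarrow> com" where
  "Set x a \<equiv> Assign x (Const 0) a"

definition For :: "vname \<Rightarrow> vname \<Rightarrow> com \<Rightarrow> com" where
  "For x y c =
     Seq (Set x (Const 0)) (While (Less (Var x) (Var y)) (Seq c (Set x (Plus (Var x) (Const 1)))))"

lemma writes_For [simp]: "writes (For x y c) = insert x (writes c)"
  by (auto simp: For_def)

text \<open>The bound \<open>y\<close> is read afresh by every test, so the body must preserve it.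
  Each iteration costs \<open>T\<close> plus three steps (sequencing, increment, test); three more
  pay for the initialisation, its sequencing and the last test.\<close>

lemma runs_For:
  assumes xy: "x \<noteq> y" "x \<notin> writes c" "y \<notin> writes c"
    and init: "I 0 (upd s x 0 0)"
    and step: "\<And>i s'. i < s y 0 \<Longrightarrow> eq_outside (insert x (writes c)) s s' \<Longrightarrow> s' x 0 = i \<Longrightarrow>
      I i s' \<Longrightarrow> runs T c (\<lambda>s''. I (Suc i) (upd s'' x 0 (Suc i))) s'"
    and post: "\<And>s'. eq_outside (insert x (writes c)) s s' \<Longrightarrow> I (s y 0) s' \<Longrightarrow> Q s'"
    and N: "s y 0 \<le> N" and T': "N * (T + 3) + 3 \<le> T'"
  shows "runs T' (For x y c) Q s"
proof -
  let ?b = "Less (Var x) (Var y)" and ?c = "Seq c (Set x (Plus (Var x) (Const 1)))"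
  let ?X = "insert x (writes c)"
  define J where "J k s' \<longleftrightarrow> eq_outside ?X s s' \<and> s' x 0 \<le> s y 0 \<and> k = s y 0 - s' x 0 \<and> I (s' x 0) s'"
    for k s'
  have "runs (s y 0 * ((T + 2) + 1) + 1) (While ?b ?c) (\<lambda>s'. (\<exists>j. J j s') \<and> \<not> bval ?b s') (upd s x 0 0)"
  proof (rule runs_While[where k = "s y 0" and T = "T + 2"])
    show "J (s y 0) (upd s x 0 0)"
      using init by (auto simp: J_def upd_def eq_outside_def)
  next
    fix k s' assume J: "J k s'" and b: "bval ?b s'"
    have y: "s' y = s y" if "eq_outside ?X s s'" for s'
      using that xy by (auto simp: eq_outside_def)
    define i where "i = s' x 0"
    have fr: "eq_outside ?X s s'" and i: "I i s'" and lt: "i < s y 0"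
      using J b y[of s'] by (auto simp: J_def i_def)
    have "runs T c (\<lambda>s''. I (Suc i) (upd s'' x 0 (Suc i)) \<and> eq_outside (writes c) s' s'') s'"
      using step[OF lt fr _ i] by (intro runs_frame) (simp add: i_def)
    then have "runs T c (\<lambda>s''. runs 1 (Set x (Plus (Var x) (Const 1))) (\<lambda>s'. \<exists>j<k. J j s') s'') s'"
    proof (rule runs_mono)
      fix s'' assume s'': "I (Suc i) (upd s'' x 0 (Suc i)) \<and> eq_outside (writes c) s' s''"
      then have "s'' x = s' x" using xy by (auto simp: eq_outside_def)
      moreover have "eq_outside ?X s (upd s'' x 0 (Suc i))"
        using s'' fr by (auto simp: eq_outside_def upd_def)
      ultimately have "J (s y 0 - Suc i) (upd s'' x 0 (Suc i))" "s'' x 0 = i"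
        using s'' lt by (auto simp: J_def i_def upd_def)
      moreover have "s y 0 - Suc i < k" using J lt by (auto simp: J_def i_def)
      ultimately show "runs 1 (Set x (Plus (Var x) (Const 1))) (\<lambda>s'. \<exists>j<k. J j s') s''"
        by (intro runs_Assign) auto
    qed simp
    then show "runs (T + 2) ?c (\<lambda>s'. \<exists>j<k. J j s') s'"
      by (rule runs_Seq) simp
  qed simp
  then have "runs (s y 0 * (T + 3) + 1) (While ?b ?c) Q (upd s x 0 0)"
  proof (rule runs_mono)
    fix s' assume s': "(\<exists>j. J j s') \<and> \<not> bval ?b s'"
    then have fr: "eq_outside ?X s s'" by (auto simp: J_def)
    then have "s' y = s y" using xy by (auto simp: eq_outside_def)
    then have "s' x 0 = s y 0" using s' by (auto simp: J_def)
    then show "Q s'" using post[OF fr] s' by (auto simp: J_def)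
  qed (simp add: numeral_3_eq_3)
  moreover have "s y 0 * (T + 3) \<le> N * (T + 3)" using N by (rule mult_right_mono) simp
  then have "2 + (s y 0 * (T + 3) + 1) \<le> T'" using T' by linarith
  ultimately show ?thesis unfolding For_def by (intro runs_Seq_Assign) simp_all
qed

section \<open>The program\<close>

abbreviation Eq :: "aexp \<Rightarrow> aexp \<Rightarrow> bexp" where
  "Eq a b \<equiv> Conj (Neg (Less a b)) (Neg (Less b a))"

text \<open>As there is no multiplication, the multiples of \<open>n\<close> are tabulated in the array \<open>M\<close>.\<close>

definition pair :: "vname \<Rightarrow> vname \<Rightarrow> aexp" where
  "pair u v = Plus (Cell ''M'' (Var u)) (Var v)"

definition triple :: "aexp \<Rightarrow> aexp \<Rightarrow> aexp" where
  "triple p w = Plus (Cell ''M'' p) w"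

text \<open>The first pass produces \<open>M[n] = n * n\<close>. That value bounds the second pass,
  which extends the table to every pair index \<open>u * n + v\<close>.\<close>

definition init_multiples :: com where
  "init_multiples =
     (let c = Assign ''M'' (Plus (Var ''i'') (Const 1)) (Plus (Cell ''M'' (Var ''i'')) (Var ''n'')) in
      Seq (For ''i'' ''n'' c)
     (Seq (Set ''m'' (Cell ''M'' (Var ''n'')))
          (For ''i'' ''m'' c)))"

definition init_labels :: com where
  "init_labels =
     For ''p'' ''m'' (For ''w'' ''n'' (Assign ''L'' (triple (Var ''p'') (Var ''w'')) (Var ''w'')))"

definition init_weights :: com where
  "init_weights = For ''v'' ''n'' (Assign ''W'' (Var ''v'') (Const 1))"

definition test_useful :: bexp where
  "test_useful =
     (let p = pair ''u'' ''v''; X = (\<lambda>x w. Cell x (triple p (Var w))) in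
      Conj (Neg (Eq (X ''L'' ''u'') (X ''L'' ''v'')))
     (Conj (Less (Const 0) (X ''S'' ''a''))
     (Conj (Less (Const 0) (X ''S'' ''b''))
           (Neg (Eq (X ''L'' ''a'') (X ''L'' ''b''))))))"

text \<open>The product \<open>P\<close> of the gain with the weight \<open>bc\<close> of the best edge so far is accumulated along
  with the gain; likewise \<open>Q\<close> below becomes the product of the current weight with the best gain.\<close>

definition compute_gain :: com where
  "compute_gain =
     Seq (Set ''g'' (Const 0))
    (Seq (Set ''P'' (Const 0))
         (For ''u'' ''n'' (For ''v'' ''n''
           (Cond test_useful
             (Seq (Set ''g'' (Plus (Var ''g'') (Const 1)))
                  (Set ''P'' (Plus (Var ''P'') (Var ''bc''))))
             Skip))))"

definition compute_cost :: com where
  "compute_cost =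
     Seq (Set ''c'' (Plus (Cell ''W'' (Var ''a'')) (Cell ''W'' (Var ''b''))))
    (Seq (Set ''Q'' (Const 0))
         (For ''i'' ''bg'' (Set ''Q'' (Plus (Var ''Q'') (Var ''c'')))))"

definition compare :: com where
  "compare =
     Cond (Less (Var ''Q'') (Var ''P''))
       (Seq (Set ''bg'' (Var ''g''))
       (Seq (Set ''bc'' (Var ''c''))
       (Seq (Set ''ba'' (Var ''a''))
            (Set ''bb'' (Var ''b'')))))
       Skip"

text \<open>The start values \<open>bg = 0\<close>, \<open>bc = 1\<close> act as an infinite ratio:
  then \<open>Q = 0\<close> and \<open>P = g\<close>, so the first edge with positive gain wins. A
  final \<open>bg = 0\<close> signals that no edge has any gain.\<close>

definition search :: com where
  "search =
     Seq (Set ''bg'' (Const 0))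
    (Seq (Set ''bc'' (Const 1))
         (For ''a'' ''n'' (For ''b'' ''n'' (Seq compute_gain (Seq compute_cost compare)))))"

text \<open>One orientation is enough, since \<open>output_edges\<close> collects unordered
  pairs.\<close>

definition add_edge :: com where
  "add_edge = Assign ''F'' (pair ''ba'' ''bb'') (Const 1)"

definition raise :: "bool \<Rightarrow> vname \<Rightarrow> com" where
  "raise d x = Assign ''W'' (Var x)
     (Plus (Cell ''W'' (Var x)) (if d then Cell ''W'' (Var x) else Const 0))"

text \<open>The two labels are saved in \<open>la\<close> and \<open>lb\<close> because the inner
  loop overwrites the label of \<open>ba\<close> itself.\<close>

definition merge_labels :: com where
  "merge_labels =
     (let X = (\<lambda>x w. Cell x (triple (Var ''p'') (Var w))) in
      For ''p'' ''m''
       (Cond (Conj (Less (Const 0) (X ''S'' ''ba'')) (Less (Const 0) (X ''S'' ''bb'')))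
         (Seq (Set ''la'' (X ''L'' ''ba''))
         (Seq (Set ''lb'' (X ''L'' ''bb''))
              (For ''w'' ''n''
                (Cond (Eq (X ''L'' ''w'') (Var ''la''))
                  (Assign ''L'' (triple (Var ''p'') (Var ''w'')) (Var ''lb''))
                  Skip))))
         Skip))"

definition round_body :: "bool \<Rightarrow> com" where
  "round_body d = Seq add_edge (Seq (raise d ''ba'') (Seq (raise d ''bb'') (Seq merge_labels search)))"

definition program :: "bool \<Rightarrow> com" where
  "program d =
     Seq init_multiples (Seq init_labels (Seq init_weights (Seq search
       (While (Less (Const 0) (Var ''bg'')) (round_body d)))))"

section \<open>Memory layout and its invariants\<close>

definition input :: "nat \<Rightarrow> (nat \<Rightarrow> nat \<Rightarrow> nat set) \<Rightarrow> state \<Rightarrow> bool" where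
  "input n S s \<longleftrightarrow> s ''n'' 0 = n \<and>
     (\<forall>u<n. \<forall>v<n. \<forall>w<n. s ''S'' ((u * n + v) * n + w) = of_bool (w \<in> S u v))"

definition tables :: "nat \<Rightarrow> (nat \<Rightarrow> nat \<Rightarrow> nat set) \<Rightarrow> state \<Rightarrow> bool" where
  "tables n S s \<longleftrightarrow> input n S s \<and> s ''m'' 0 = n * n \<and> (\<forall>i\<le>n * n. s ''M'' i = i * n)"

definition repr :: "nat \<Rightarrow> (nat \<Rightarrow> nat \<Rightarrow> nat \<Rightarrow> nat) \<Rightarrow> (nat \<Rightarrow> nat) \<Rightarrow> state \<Rightarrow> bool" where
  "repr n L W s \<longleftrightarrow> (\<forall>u<n. \<forall>v<n. \<forall>w<n. s ''L'' ((u * n + v) * n + w) = L u v w) \<and>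
     (\<forall>v<n. s ''W'' v = W v)"

lemma index_less: "u < n \<Longrightarrow> v < n \<Longrightarrow> u * n + v < n * (n::nat)"
proof -
  assume "u < n" "v < n"
  then have "(u + 1) * n \<le> n * n" by (intro mult_right_mono) auto
  with \<open>v < n\<close> show ?thesis by simp
qed

lemma index_eq_iff:
  assumes "w < n" "w' < (n::nat)"
  shows "p * n + w = p' * n + w' \<longleftrightarrow> p = p' \<and> w = w'"
proof
  assume "p * n + w = p' * n + w'"
  then have "(p * n + w) div n = (p' * n + w') div n" "(p * n + w) mod n = (p' * n + w') mod n"
    by simp_all
  then show "p = p' \<and> w = w'" using assms by simp
qed simp

lemma input_encode: "input n S (encode n S)"
proof -
  have "encode n S ''S'' ((u * n + v) * n + w) = of_bool (w \<in> S u v)"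
    if "u < n" "v < n" "w < n" for u v w
  proof -
    have "(\<exists>u'<n. \<exists>v'<n. \<exists>w'<n. (u * n + v) * n + w = (u' * n + v') * n + w' \<and> w' \<in> S u' v')
      \<longleftrightarrow> w \<in> S u v"
      using that by (auto simp: index_eq_iff)
    then show ?thesis by (simp add: encode_def)
  qed
  then show ?thesis by (simp add: input_def encode_def)
qed

lemma tables_cong:
  assumes "tables n S s" "eq_outside X s s'" "X \<inter> {''n'', ''S'', ''m'', ''M''} = {}"
  shows "tables n S s'"
proof -
  have "s' ''n'' = s ''n''" "s' ''S'' = s ''S''" "s' ''m'' = s ''m''" "s' ''M'' = s ''M''"
    using assms(3) by (auto intro!: eq_outsideD[OF assms(2)])
  then show ?thesis using assms(1) by (simp add: tables_def input_def)
qed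

lemma repr_cong:
  assumes "repr n L W s" "eq_outside X s s'" "X \<inter> {''L'', ''W''} = {}"
  shows "repr n L W s'"
proof -
  have "s' ''L'' = s ''L''" "s' ''W'' = s ''W''"
    using assms(3) by (auto intro!: eq_outsideD[OF assms(2)])
  then show ?thesis using assms(1) by (simp add: repr_def)
qed

section \<open>Correctness of the subroutines\<close>

lemma runs_init_multiples:
  assumes "input n S s" "s ''M'' 0 = 0"
  shows "runs ((n + n * n) * 4 + 10) init_multiples (tables n S) s"
proof -
  have n: "s ''n'' 0 = n" using assms by (simp add: input_def)
  let ?c = "Assign ''M'' (Plus (Var ''i'') (Const 1)) (Plus (Cell ''M'' (Var ''i'')) (Var ''n''))"
  have loop: "runs (N * 4 + 3) (For ''i'' y ?c) (\<lambda>s'. \<forall>j\<le>N. s' ''M'' j = j * n) s"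
    if "s ''n'' 0 = n" "s ''M'' 0 = 0" "s y 0 = N" "y \<notin> {''i'', ''M''}" for s y N
  proof (rule runs_For[where I = "\<lambda>i s'. \<forall>j\<le>i. s' ''M'' j = j * n" and T = 1 and N = N])
    fix i s' assume s': "eq_outside (insert ''i'' (writes ?c)) s s'" "s' ''i'' 0 = i"
      "\<forall>j\<le>i. s' ''M'' j = j * n"
    then have "s' ''n'' = s ''n''" by (auto intro!: eq_outsideD)
    then show "runs 1 ?c (\<lambda>s''. \<forall>j\<le>Suc i. upd s'' ''i'' 0 (Suc i) ''M'' j = j * n) s'"
      using s' that by (intro runs_Assign) (auto simp: upd_def le_Suc_eq)
  qed (use that in \<open>auto simp: upd_def\<close>)
  show ?thesis
    unfolding init_multiples_def Let_def
  proof (rule runs_Seq[OF runs_conseq[OF loop[where s = s and y = "''n''" and N = n] order_refl]])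
    fix s1 assume s1: "\<forall>j\<le>n. s1 ''M'' j = j * n" "eq_outside (writes (For ''i'' ''n'' ?c)) s s1"
    let ?s2 = "upd s1 ''m'' 0 (n * n)"
    have eqs: "s1 ''n'' = s ''n''" "s1 ''S'' = s ''S''"
      using s1(2) by (auto intro!: eq_outsideD[OF s1(2)])
    have M0: "s1 ''M'' 0 = 0" using s1(1) by auto
    have "runs (n * n * 4 + 3) (For ''i'' ''m'' ?c) (tables n S) ?s2"
    proof (rule runs_conseq[OF loop[where s = ?s2 and y = "''m''" and N = "n * n"]])
      fix s3 assume s3: "\<forall>j\<le>n * n. s3 ''M'' j = j * n"
        "eq_outside (writes (For ''i'' ''m'' ?c)) ?s2 s3"
      have "s3 ''n'' = s ''n''" "s3 ''S'' = s ''S''" "s3 ''m'' = ?s2 ''m''"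
        using eqs by (auto simp: eq_outsideD[OF s3(2)] upd_def)
      then show "tables n S s3" using s3(1) assms(1) by (auto simp: tables_def input_def upd_def)
    qed (use eqs n M0 in \<open>auto simp: upd_def\<close>)
    then show "runs (n * n * 4 + 5) (Seq (Set ''m'' (Cell ''M'' (Var ''n'')))
          (For ''i'' ''m'' ?c)) (tables n S) s1"
      using s1(1) eqs n by (intro runs_Seq_Assign) auto
  qed (use n assms(2) in auto)
qed

lemma runs_init_labels:
  assumes "tables n S s"
  shows "runs (n * n * (n * 4 + 6) + 3) init_labels
    (\<lambda>s'. \<forall>u<n. \<forall>v<n. \<forall>w<n. s' ''L'' ((u * n + v) * n + w) = w) s"
proof -
  let ?c = "Assign ''L'' (triple (Var ''p'') (Var ''w'')) (Var ''w'')"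
  let ?I = "\<lambda>i s'. \<forall>p<i. \<forall>w<n. s' ''L'' (p * n + w) = w"
  have nm: "s ''n'' 0 = n" "s ''m'' 0 = n * n" and M: "\<And>i. i < n * n \<Longrightarrow> s ''M'' i = i * n"
    using assms by (auto simp: tables_def input_def)
  show ?thesis unfolding init_labels_def
  proof (rule runs_For[where I = ?I and T = "n * 4 + 3" and N = "n * n"])
    fix i s1 assume i: "i < s ''m'' 0" and fr: "eq_outside (insert ''p'' (writes (For ''w'' ''n'' ?c))) s s1"
      and p: "s1 ''p'' 0 = i" and I: "?I i s1"
    let ?J = "\<lambda>j s'. ?I i s' \<and> (\<forall>w<j. s' ''L'' (i * n + w) = w)"
    have eqs: "s1 ''n'' = s ''n''" "s1 ''M'' = s ''M''" by (auto simp: eq_outsideD[OF fr])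
    show "runs (n * 4 + 3) (For ''w'' ''n'' ?c) (\<lambda>s'. ?I (Suc i) (upd s' ''p'' 0 (Suc i))) s1"
    proof (rule runs_For[where I = ?J and T = 1 and N = n])
      fix j s2 assume j: "j < s1 ''n'' 0" and fr2: "eq_outside (insert ''w'' (writes ?c)) s1 s2"
        and w: "s2 ''w'' 0 = j" and J: "?J j s2"
      have eqs2: "s2 ''p'' = s1 ''p''" "s2 ''M'' = s1 ''M''" by (auto simp: eq_outsideD[OF fr2])
      have "aval (triple (Var ''p'') (Var ''w'')) s2 = i * n + j"
        using w eqs2 eqs p M i nm by (simp add: triple_def)
      then show "runs 1 ?c (\<lambda>s'. ?J (Suc j) (upd s' ''w'' 0 (Suc j))) s2"
        using J w j eqs nm
        by (intro runs_Assign) (auto simp: upd_def less_Suc_eq index_eq_iff)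
    qed (use I eqs nm in \<open>auto simp: upd_def less_Suc_eq\<close>)
  next
    fix s' assume "?I (s ''m'' 0) s'"
    then show "\<forall>u<n. \<forall>v<n. \<forall>w<n. s' ''L'' ((u * n + v) * n + w) = w"
      using nm index_less by auto
  qed (use nm in auto)
qed

lemma runs_init_weights:
  assumes "s ''n'' 0 = n"
  shows "runs (n * 4 + 3) init_weights (\<lambda>s'. \<forall>v<n. s' ''W'' v = 1) s"
  unfolding init_weights_def
  by (rule runs_For[where I = "\<lambda>i s'. \<forall>v<i. s' ''W'' v = 1" and T = 1 and N = n])
    (use assms in \<open>auto intro!: runs_Assign simp: upd_def less_Suc_eq\<close>)

lemma bval_test_useful:
  assumes "tables n S s" "repr n L W s" "s ''u'' 0 = u" "s ''v'' 0 = v" "s ''a'' 0 = a" "s ''b'' 0 = b"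
    "u < n" "v < n" "a < n" "b < n"
  shows "bval test_useful s \<longleftrightarrow> useful S L a b u v"
proof -
  have M: "s ''M'' i = i * n" if "i < n * n" for i
    using assms(1) that by (auto simp: tables_def)
  have un: "u < n * n" using assms(7) by (metis le_square less_le_trans)
  have "aval (triple (pair ''u'' ''v'') (Var w)) s = (u * n + v) * n + s w 0" for w
    using assms un index_less[of u n v] by (simp add: triple_def pair_def M)
  then show ?thesis using assms unfolding test_useful_def Let_def
    by (auto simp: useful_def tables_def input_def repr_def)
qed

lemma runs_compute_gain:
  assumes tab: "tables n S s" and rep: "repr n L W s" and a: "s ''a'' 0 < n" and b: "s ''b'' 0 < n"
  shows "runs (n * (n * 7 + 6) + 7) compute_gain
    (\<lambda>s'. s' ''g'' 0 = gain n S L (s ''a'' 0) (s ''b'' 0) \<and>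
          s' ''P'' 0 = s ''bc'' 0 * gain n S L (s ''a'' 0) (s ''b'' 0)) s"
proof -
  let ?inner = "Cond test_useful
             (Seq (Set ''g'' (Plus (Var ''g'') (Const 1)))
                  (Set ''P'' (Plus (Var ''P'') (Var ''bc''))))
             Skip"
  let ?a = "s ''a'' 0" and ?b = "s ''b'' 0"
  define U where "U u v = (of_bool (useful S L ?a ?b u v) :: nat)" for u v
  have n: "s ''n'' 0 = n" using tab by (auto simp: tables_def input_def)
  let ?I = "\<lambda>i s'. s' ''g'' 0 = (\<Sum>u<i. \<Sum>v<n. U u v) \<and> s' ''P'' 0 = s ''bc'' 0 * s' ''g'' 0"
  let ?s0 = "upd (upd s ''g'' 0 0) ''P'' 0 0"
  have "runs (n * (n * 7 + 6) + 3) (For ''u'' ''n'' (For ''v'' ''n'' ?inner)) (?I n) ?s0"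
  proof (rule runs_For[where I = ?I and T = "n * 7 + 3" and N = n])
    fix i s1 assume i: "i < ?s0 ''n'' 0"
      and fr: "eq_outside (insert ''u'' (writes (For ''v'' ''n'' ?inner))) ?s0 s1"
      and u: "s1 ''u'' 0 = i" and I: "?I i s1"
    have n1: "s1 ''n'' = s ''n''" by (auto simp: eq_outsideD[OF fr] upd_def)
    let ?J = "\<lambda>j s'. s' ''g'' 0 = (\<Sum>u<i. \<Sum>v<n. U u v) + (\<Sum>v<j. U i v) \<and>
      s' ''P'' 0 = s ''bc'' 0 * s' ''g'' 0"
    show "runs (n * 7 + 3) (For ''v'' ''n'' ?inner) (\<lambda>s'. ?I (Suc i) (upd s' ''u'' 0 (Suc i))) s1"
    proof (rule runs_For[where I = ?J and T = 4 and N = n])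
      fix j s2 assume j: "j < s1 ''n'' 0" and fr2: "eq_outside (insert ''v'' (writes ?inner)) s1 s2"
        and v: "s2 ''v'' 0 = j" and J: "?J j s2"
      have frs: "eq_outside {''g'', ''P'', ''u'', ''v''} s s2"
        using fr fr2 by (auto simp: eq_outside_def upd_def)
      have "tables n S s2" by (rule tables_cong[OF tab frs]) auto
      moreover have "repr n L W s2" by (rule repr_cong[OF rep frs]) auto
      moreover have "s2 ''u'' = s1 ''u''" by (auto simp: eq_outsideD[OF fr2])
      moreover have "s2 ''a'' = s ''a''" "s2 ''b'' = s ''b''" and bc: "s2 ''bc'' = s ''bc''"
        by (auto simp: eq_outsideD[OF frs])
      ultimately have "bval test_useful s2 \<longleftrightarrow> useful S L ?a ?b i j"
        using i j a b u v n n1 by (intro bval_test_useful) (auto simp: upd_def)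
      then show "runs 4 ?inner (\<lambda>s'. ?J (Suc j) (upd s' ''v'' 0 (Suc j))) s2"
        using J bc
        by (intro runs_Cond[where T = 3] runs_Seq_Assign[where ?T2.0 = 1] runs_Assign runs_Skip)
          (auto simp: upd_def U_def)
    qed (use I n n1 in \<open>auto simp: upd_def\<close>)
  qed (use n in \<open>auto simp: upd_def\<close>)
  then have "runs (n * (n * 7 + 6) + 3) (For ''u'' ''n'' (For ''v'' ''n'' ?inner))
    (\<lambda>s'. s' ''g'' 0 = gain n S L ?a ?b \<and> s' ''P'' 0 = s ''bc'' 0 * gain n S L ?a ?b) ?s0"
    by (rule runs_mono) (auto simp: gain_def U_def)
  then show ?thesis unfolding compute_gain_def
    by (intro runs_Seq_Assign[where ?T2.0 = "n * (n * 7 + 6) + 5"]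
        runs_Seq_Assign[where ?T2.0 = "n * (n * 7 + 6) + 3"]) auto
qed

lemma runs_compute_cost:
  assumes bg: "s ''bg'' 0 \<le> N"
  defines "c \<equiv> s ''W'' (s ''a'' 0) + s ''W'' (s ''b'' 0)"
  shows "runs (N * 4 + 7) compute_cost (\<lambda>s'. s' ''c'' 0 = c \<and> s' ''Q'' 0 = c * s ''bg'' 0) s"
proof -
  let ?s0 = "upd (upd s ''c'' 0 c) ''Q'' 0 0"
  let ?c = "Set ''Q'' (Plus (Var ''Q'') (Var ''c''))"
  have "runs (N * 4 + 3) (For ''i'' ''bg'' ?c) (\<lambda>s'. s' ''c'' 0 = c \<and> s' ''Q'' 0 = c * s ''bg'' 0) ?s0"
    by (rule runs_For[where I = "\<lambda>i s'. s' ''c'' 0 = c \<and> s' ''Q'' 0 = c * i" and T = 1 and N = N])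
      (use bg in \<open>auto intro!: runs_Assign simp: upd_def\<close>)
  then show ?thesis unfolding compute_cost_def
    by (intro runs_Seq_Assign[where ?T2.0 = "N * 4 + 5"] runs_Seq_Assign[where ?T2.0 = "N * 4 + 3"])
      (auto simp: c_def upd_def)
qed

text \<open>\<open>(ba, bb)\<close> minimises weight over gain among the candidates in \<open>A\<close>. As long as no candidate
  has positive gain, \<open>bg = 0\<close> and \<open>ba\<close>, \<open>bb\<close> are meaningless.\<close>

definition best ::
  "nat \<Rightarrow> (nat \<Rightarrow> nat \<Rightarrow> nat set) \<Rightarrow> (nat \<Rightarrow> nat \<Rightarrow> nat \<Rightarrow> nat) \<Rightarrow> (nat \<Rightarrow> nat) \<Rightarrow> (nat \<times> nat) set \<Rightarrow> state \<Rightarrow> bool" where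
  "best n S L W A s \<longleftrightarrow> 0 < s ''bc'' 0 \<and>
     (\<forall>(a, b)\<in>A. s ''bc'' 0 * gain n S L a b \<le> (W a + W b) * s ''bg'' 0) \<and>
     (s ''bg'' 0 = 0 \<or>
        s ''ba'' 0 < n \<and> s ''bb'' 0 < n \<and> s ''bg'' 0 = gain n S L (s ''ba'' 0) (s ''bb'' 0) \<and>
        s ''bc'' 0 = W (s ''ba'' 0) + W (s ''bb'' 0))"

text \<open>Cross multiplication; a best gain of zero forces all gains seen so far to be zero.\<close>

lemma ratio_trans:
  fixes bc bg c g c' g' :: nat
  assumes "bc * g' \<le> c' * bg" "c * bg < bc * g" "0 < bc"
  shows "c * g' \<le> c' * g"
proof (cases "bg = 0")
  case True
  then show ?thesis using assms by simp
next
  case False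
  have "(c * g') * (bg * bc) = (c * bg) * (bc * g')" by (simp add: mult_ac)
  also have "\<dots> \<le> (bc * g) * (c' * bg)" by (rule mult_le_mono) (use assms in simp_all)
  also have "\<dots> = (c' * g) * (bg * bc)" by (simp add: mult_ac)
  finally show ?thesis using False assms(3) by simp
qed

text \<open>If the new candidate wins, \<open>ratio_trans\<close> passes optimality over the old
  candidates on to it. Otherwise \<open>P \<le> Q\<close> is exactly the inequality that
  \<open>best\<close> demands for it. Positivity of \<open>c\<close> keeps \<open>bc\<close>
  positive.\<close>

lemma runs_compare:
  assumes best: "best n S L W A s" and ab: "s ''a'' 0 < n" "s ''b'' 0 < n"
    and g: "s ''g'' 0 = gain n S L (s ''a'' 0) (s ''b'' 0)" "s ''P'' 0 = s ''bc'' 0 * s ''g'' 0"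
    and c: "s ''c'' 0 = W (s ''a'' 0) + W (s ''b'' 0)" "s ''Q'' 0 = s ''c'' 0 * s ''bg'' 0"
    and pos: "0 < s ''c'' 0"
  shows "runs 8 compare (best n S L W (insert (s ''a'' 0, s ''b'' 0) A)) s"
  unfolding compare_def
proof (rule runs_Cond[where T = 7])
  assume "bval (Less (Var ''Q'') (Var ''P'')) s"
  then have less: "s ''c'' 0 * s ''bg'' 0 < s ''bc'' 0 * s ''g'' 0" using g c by simp
  let ?s = "upd (upd (upd (upd s ''bg'' 0 (s ''g'' 0)) ''bc'' 0 (s ''c'' 0)) ''ba'' 0 (s ''a'' 0))
    ''bb'' 0 (s ''b'' 0)"
  have "s ''c'' 0 * gain n S L a b \<le> (W a + W b) * s ''g'' 0" if "(a, b) \<in> A" for a b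
    using best that by (intro ratio_trans[OF _ less]) (auto simp: best_def)
  then have "best n S L W (insert (s ''a'' 0, s ''b'' 0) A) ?s"
    using ab g c pos by (auto simp: best_def upd_def)
  then show "runs 7 (Seq (Set ''bg'' (Var ''g'')) (Seq (Set ''bc'' (Var ''c''))
       (Seq (Set ''ba'' (Var ''a'')) (Set ''bb'' (Var ''b'')))))
     (best n S L W (insert (s ''a'' 0, s ''b'' 0) A)) s"
    by (intro runs_Seq_Assign[where ?T2.0 = 5] runs_Seq_Assign[where ?T2.0 = 3]
        runs_Seq_Assign[where ?T2.0 = 1] runs_Assign) (simp_all add: upd_def)
next
  assume "\<not> bval (Less (Var ''Q'') (Var ''P'')) s"
  then have "s ''bc'' 0 * s ''g'' 0 \<le> s ''c'' 0 * s ''bg'' 0" using g c by simp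
  then show "runs 7 Skip (best n S L W (insert (s ''a'' 0, s ''b'' 0) A)) s"
    using best g c by (intro runs_Skip) (auto simp: best_def)
qed simp

lemma best_cong:
  assumes "best n S L W A s" "eq_outside X s s'" "X \<inter> {''ba'', ''bb'', ''bg'', ''bc''} = {}"
  shows "best n S L W A s'"
proof -
  have "s' ''ba'' = s ''ba''" "s' ''bb'' = s ''bb''" "s' ''bg'' = s ''bg''" "s' ''bc'' = s ''bc''"
    using assms(3) by (auto intro!: eq_outsideD[OF assms(2)])
  then show ?thesis using assms(1) by (simp add: best_def)
qed

lemma best_upd:
  "x \<notin> {''ba'', ''bb'', ''bg'', ''bc''} \<Longrightarrow> best n S L W A (upd s x i k) \<longleftrightarrow> best n S L W A s"
  by (auto simp: best_def upd_def)

lemma runs_candidate: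
  assumes tab: "tables n S s" and rep: "repr n L W s" and ab: "s ''a'' 0 < n" "s ''b'' 0 < n"
    and W: "\<And>x. 0 < W x" and best: "best n S L W A s"
  shows "runs (n * (n * 11 + 6) + 24) (Seq compute_gain (Seq compute_cost compare))
    (best n S L W (insert (s ''a'' 0, s ''b'' 0) A)) s"
proof (rule runs_Seq[OF runs_conseq[OF runs_compute_gain[OF tab rep ab] order_refl]])
  let ?a = "s ''a'' 0" and ?b = "s ''b'' 0"
  fix s1 assume 1: "s1 ''g'' 0 = gain n S L ?a ?b \<and> s1 ''P'' 0 = s ''bc'' 0 * gain n S L ?a ?b"
    and fr1: "eq_outside (writes compute_gain) s s1"
  have w1: "writes compute_gain = {''g'', ''P'', ''u'', ''v''}" by (auto simp: compute_gain_def)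
  have eqs1: "s1 ''a'' = s ''a''" "s1 ''b'' = s ''b''" "s1 ''bc'' = s ''bc''" "s1 ''W'' = s ''W''"
    by (auto simp: eq_outsideD[OF fr1] w1)
  have best1: "best n S L W A s1" by (rule best_cong[OF best fr1]) (auto simp: w1)
  \<comment> \<open>\<open>bg\<close> is zero or a gain; this bounds the time of the repeated
    addition that computes \<open>Q\<close>.\<close>
  have bg: "s1 ''bg'' 0 \<le> n * n" using best1 gain_le by (auto simp: best_def)
  show "runs (n * n * 4 + 16) (Seq compute_cost compare) (best n S L W (insert (?a, ?b) A)) s1"
  proof (rule runs_Seq[OF runs_conseq[OF runs_compute_cost[where s = s1 and N = "n * n", OF bg] order_refl]])
    fix s2 assume 2: "s2 ''c'' 0 = s1 ''W'' (s1 ''a'' 0) + s1 ''W'' (s1 ''b'' 0) \<and>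
        s2 ''Q'' 0 = (s1 ''W'' (s1 ''a'' 0) + s1 ''W'' (s1 ''b'' 0)) * s1 ''bg'' 0"
      and fr2: "eq_outside (writes compute_cost) s1 s2"
    have w2: "writes compute_cost = {''c'', ''Q'', ''i''}" by (auto simp: compute_cost_def)
    have eqs2: "s2 ''a'' = s1 ''a''" "s2 ''b'' = s1 ''b''" "s2 ''bc'' = s1 ''bc''"
      "s2 ''bg'' = s1 ''bg''" "s2 ''g'' = s1 ''g''" "s2 ''P'' = s1 ''P''"
      by (auto simp: eq_outsideD[OF fr2] w2)
    have best2: "best n S L W A s2" by (rule best_cong[OF best1 fr2]) (auto simp: w2)
    have c: "s1 ''W'' (s1 ''a'' 0) + s1 ''W'' (s1 ''b'' 0) = W ?a + W ?b"
      using rep ab eqs1 by (simp add: repr_def)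
    have "runs 8 compare (best n S L W (insert (s2 ''a'' 0, s2 ''b'' 0) A)) s2"
      using 1 2 c eqs1 eqs2 ab W[of ?a] by (intro runs_compare[OF best2]) auto
    then show "runs 8 compare (best n S L W (insert (?a, ?b) A)) s2"
      using eqs1 eqs2 by simp
  qed simp
qed (simp add: algebra_simps)

lemma writes_search:
  "writes search = {''a'', ''b'', ''u'', ''v'', ''g'', ''P'', ''c'', ''Q'', ''i'', ''bg'', ''bc'', ''ba'', ''bb''}"
  by (auto simp: search_def compute_gain_def compute_cost_def compare_def)

lemma runs_search:
  assumes tab: "tables n S s" and rep: "repr n L W s" and W: "\<And>x. 0 < W x"
  shows "runs (n * (n * (n * (n * 11 + 6) + 27) + 6) + 7) search
    (best n S L W ({..<n} \<times> {..<n})) s"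
proof -
  let ?c = "Seq compute_gain (Seq compute_cost compare)"
  let ?s0 = "upd (upd s ''bg'' 0 0) ''bc'' 0 1"
  let ?T = "n * (n * 11 + 6) + 24"
  let ?I = "\<lambda>i. best n S L W ({..<i} \<times> {..<n})"
  have n: "s ''n'' 0 = n" using tab by (simp add: tables_def input_def)
  have wc: "writes ?c = writes search - {''a'', ''b''}"
    by (auto simp: search_def compute_gain_def compute_cost_def compare_def)
  have "runs (n * (n * (?T + 3) + 6) + 3) (For ''a'' ''n'' (For ''b'' ''n'' ?c)) (?I n) ?s0"
  proof (rule runs_For[where I = ?I and T = "n * (?T + 3) + 3" and N = n])
    fix i s1 assume i: "i < ?s0 ''n'' 0"
      and fr1: "eq_outside (insert ''a'' (writes (For ''b'' ''n'' ?c))) ?s0 s1"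
      and a: "s1 ''a'' 0 = i" and I: "?I i s1"
    have fr1': "eq_outside (writes search) s s1"
      using fr1 unfolding writes_For wc writes_search by (auto simp: eq_outside_def upd_def)
    have n1: "s1 ''n'' = s ''n''" by (auto simp: eq_outsideD[OF fr1'] writes_search)
    let ?J = "\<lambda>j. best n S L W ({..<i} \<times> {..<n} \<union> {i} \<times> {..<j})"
    show "runs (n * (?T + 3) + 3) (For ''b'' ''n'' ?c) (\<lambda>s'. ?I (Suc i) (upd s' ''a'' 0 (Suc i))) s1"
    proof (rule runs_For[where I = ?J and T = ?T and N = n])
      fix j s2 assume j: "j < s1 ''n'' 0" and fr2: "eq_outside (insert ''b'' (writes ?c)) s1 s2"
        and b: "s2 ''b'' 0 = j" and J: "?J j s2"
      have fr2': "eq_outside (writes search) s s2"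
        using fr1' fr2 unfolding wc writes_search by (auto simp: eq_outside_def)
      have a2: "s2 ''a'' = s1 ''a''" using fr2 unfolding wc writes_search eq_outside_def by simp
      have "tables n S s2" by (rule tables_cong[OF tab fr2']) (auto simp: writes_search)
      moreover have "repr n L W s2" by (rule repr_cong[OF rep fr2']) (auto simp: writes_search)
      ultimately have "runs ?T ?c (best n S L W (insert (s2 ''a'' 0, s2 ''b'' 0)
          ({..<i} \<times> {..<n} \<union> {i} \<times> {..<j}))) s2"
        using i j a b a2 n n1 W J by (intro runs_candidate) (auto simp: upd_def)
      moreover have "insert (i, j) ({..<i} \<times> {..<n} \<union> {i} \<times> {..<j}) =
          {..<i} \<times> {..<n} \<union> {i} \<times> {..<Suc j}" by auto
      ultimately show "runs ?T ?c (\<lambda>s'. ?J (Suc j) (upd s' ''b'' 0 (Suc j))) s2"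
        using a b a2 by (simp add: best_upd)
    next
      fix s' assume J: "?J (s1 ''n'' 0) s'"
      have "{..<i} \<times> {..<n} \<union> {i} \<times> {..<n} = {..<Suc i} \<times> {..<n}" by auto
      then show "?I (Suc i) (upd s' ''a'' 0 (Suc i))" using J n n1 by (simp add: best_upd)
    qed (use I n n1 in \<open>auto simp: best_upd compute_gain_def compute_cost_def compare_def\<close>)
  qed (use n in \<open>auto simp: best_def upd_def compute_gain_def compute_cost_def compare_def\<close>)
  then show ?thesis unfolding search_def
    by (intro runs_Seq_Assign[where ?T2.0 = "n * (n * (?T + 3) + 6) + 5"]
        runs_Seq_Assign[where ?T2.0 = "n * (n * (?T + 3) + 6) + 3"]) (auto simp: upd_def algebra_simps)
qed

lemma runs_merge_labels:
  assumes tab: "tables n S s" and rep: "repr n L W s" and ab: "s ''ba'' 0 < n" "s ''bb'' 0 < n"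
  shows "runs (n * n * (n * 5 + 11) + 3) merge_labels
    (repr n (relabel S (s ''ba'' 0) (s ''bb'' 0) L) W) s"
proof -
  let ?a = "s ''ba'' 0" and ?b = "s ''bb'' 0"
  let ?X = "\<lambda>x w. Cell x (triple (Var ''p'') (Var w))"
  let ?d = "Cond (Eq (?X ''L'' ''w'') (Var ''la''))
    (Assign ''L'' (triple (Var ''p'') (Var ''w'')) (Var ''lb'')) Skip"
  let ?c = "Cond (Conj (Less (Const 0) (?X ''S'' ''ba'')) (Less (Const 0) (?X ''S'' ''bb'')))
    (Seq (Set ''la'' (?X ''L'' ''ba'')) (Seq (Set ''lb'' (?X ''L'' ''bb'')) (For ''w'' ''n'' ?d))) Skip"
  \<comment> \<open>The target contents of cell \<open>p * n + w\<close>, expressed through the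
    memory before the loop; the invariants say which cells already hold it.\<close>
  define new where "new p w =
    (if 0 < s ''S'' (p * n + ?a) \<and> 0 < s ''S'' (p * n + ?b) \<and> s ''L'' (p * n + w) = s ''L'' (p * n + ?a)
     then s ''L'' (p * n + ?b) else s ''L'' (p * n + w))" for p w
  let ?I = "\<lambda>i s'. \<forall>p w. w < n \<longrightarrow> s' ''L'' (p * n + w) = (if p < i then new p w else s ''L'' (p * n + w))"
  have nm: "s ''n'' 0 = n" "s ''m'' 0 = n * n" and M: "\<And>i. i < n * n \<Longrightarrow> s ''M'' i = i * n"
    using tab by (auto simp: tables_def input_def)
  have wr: "writes ?c = {''la'', ''lb'', ''w'', ''L''}" by auto
  have "runs (n * n * (n * 5 + 11) + 3) (For ''p'' ''m'' ?c) (\<lambda>s'. ?I (n * n) s' \<and> s' ''W'' = s ''W'') s"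
  proof (rule runs_For[where I = ?I and T = "n * 5 + 8" and N = "n * n"])
    fix i s1 assume i: "i < s ''m'' 0" and fr: "eq_outside (insert ''p'' (writes ?c)) s s1"
      and p: "s1 ''p'' 0 = i" and I: "?I i s1"
    have eqs: "s1 ''n'' = s ''n''" "s1 ''M'' = s ''M''" "s1 ''S'' = s ''S''"
        "s1 ''ba'' = s ''ba''" "s1 ''bb'' = s ''bb''"
      unfolding wr by (auto simp: eq_outsideD[OF fr[unfolded wr]])
    have idx: "aval (triple (Var ''p'') (Var w)) s' = i * n + s' w 0"
      if "s' ''p'' = s1 ''p''" "s' ''M'' = s1 ''M''" for w s'
      using that p eqs M i nm by (simp add: triple_def)
    show "runs (n * 5 + 8) ?c (\<lambda>s'. ?I (Suc i) (upd s' ''p'' 0 (Suc i))) s1"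
    proof (rule runs_Cond[where T = "n * 5 + 7"])
      assume "bval (Conj (Less (Const 0) (?X ''S'' ''ba'')) (Less (Const 0) (?X ''S'' ''bb''))) s1"
      then have both: "0 < s ''S'' (i * n + ?a)" "0 < s ''S'' (i * n + ?b)"
        using idx[of s1] eqs by auto
      let ?la = "s ''L'' (i * n + ?a)" and ?lb = "s ''L'' (i * n + ?b)"
      let ?s2 = "upd (upd s1 ''la'' 0 ?la) ''lb'' 0 ?lb"
      let ?J = "\<lambda>j s'. \<forall>p w. w < n \<longrightarrow> s' ''L'' (p * n + w) =
        (if p < i \<or> p = i \<and> w < j then new p w else s ''L'' (p * n + w))"
      have "runs (n * 5 + 3) (For ''w'' ''n'' ?d) (\<lambda>s'. ?I (Suc i) (upd s' ''p'' 0 (Suc i))) ?s2"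
      proof (rule runs_For[where I = ?J and T = 2 and N = n])
        show "?J 0 (upd ?s2 ''w'' 0 0)" using I by (auto simp: upd_def)
      next
        fix j s3 assume j: "j < ?s2 ''n'' 0" and fr3: "eq_outside (insert ''w'' (writes ?d)) ?s2 s3"
          and w: "s3 ''w'' 0 = j" and J: "?J j s3"
        have eqs3: "s3 ''p'' = s1 ''p''" "s3 ''M'' = s1 ''M''" "s3 ''la'' 0 = ?la" "s3 ''lb'' 0 = ?lb"
          by (auto simp: eq_outsideD[OF fr3] upd_def)
        have jn: "j < n" using j eqs nm by (simp add: upd_def)
        have idx3: "aval (triple (Var ''p'') (Var ''w'')) s3 = i * n + j"
          using idx[OF eqs3(1,2)] w by simp
        \<comment> \<open>Cell \<open>j\<close> of the current row has not been rewritten yet, so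
          the test sees its original label.\<close>
        have cur: "s3 ''L'' (i * n + j) = s ''L'' (i * n + j)" using J jn by auto
        show "runs 2 ?d (\<lambda>s'. ?J (Suc j) (upd s' ''w'' 0 (Suc j))) s3"
        proof (rule runs_Cond[where T = 1])
          assume "bval (Eq (?X ''L'' ''w'') (Var ''la'')) s3"
          then have "new i j = ?lb" using cur idx3 eqs3 both by (auto simp: new_def)
          then show "runs 1 (Assign ''L'' (triple (Var ''p'') (Var ''w'')) (Var ''lb''))
              (\<lambda>s'. ?J (Suc j) (upd s' ''w'' 0 (Suc j))) s3"
            using J idx3 eqs3 jn
            by (intro runs_Assign) (auto simp: upd_def index_eq_iff less_Suc_eq)
        next
          assume "\<not> bval (Eq (?X ''L'' ''w'') (Var ''la'')) s3"
          then have "new i j = s ''L'' (i * n + j)" using cur idx3 eqs3 by (auto simp: new_def)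
          then show "runs 1 Skip (\<lambda>s'. ?J (Suc j) (upd s' ''w'' 0 (Suc j))) s3"
            using J cur by (intro runs_Skip) (auto simp: upd_def less_Suc_eq)
        qed simp
      next
        fix s' assume "?J (?s2 ''n'' 0) s'"
        then show "?I (Suc i) (upd s' ''p'' 0 (Suc i))"
          using nm eqs by (auto simp: upd_def less_Suc_eq)
      qed (use nm eqs in \<open>auto simp: upd_def\<close>)
      moreover have "s1 ''L'' (i * n + ?a) = ?la" "s1 ''L'' (i * n + ?b) = ?lb" using I ab by auto
      moreover have "aval (triple (Var ''p'') (Var ''ba'')) s1 = i * n + ?a"
        "aval (triple (Var ''p'') (Var ''bb'')) (upd s1 ''la'' 0 ?la) = i * n + ?b"
        using idx[of s1] idx[of "upd s1 ''la'' 0 ?la"] eqs by (auto simp: upd_def)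
      ultimately show "runs (n * 5 + 7)
        (Seq (Set ''la'' (?X ''L'' ''ba'')) (Seq (Set ''lb'' (?X ''L'' ''bb'')) (For ''w'' ''n'' ?d)))
        (\<lambda>s'. ?I (Suc i) (upd s' ''p'' 0 (Suc i))) s1"
        by (intro runs_Seq_Assign[where ?T2.0 = "n * 5 + 5"]
            runs_Seq_Assign[where ?T2.0 = "n * 5 + 3"]) (auto simp: upd_def)
    next
      assume "\<not> bval (Conj (Less (Const 0) (?X ''S'' ''ba'')) (Less (Const 0) (?X ''S'' ''bb''))) s1"
      then have "\<not> (0 < s ''S'' (i * n + ?a) \<and> 0 < s ''S'' (i * n + ?b))"
        using idx[of s1] eqs by auto
      then show "runs (n * 5 + 7) Skip (\<lambda>s'. ?I (Suc i) (upd s' ''p'' 0 (Suc i))) s1"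
        using I by (intro runs_Skip) (auto simp: upd_def new_def less_Suc_eq)
    qed simp
  next
    fix s' assume fr: "eq_outside (insert ''p'' (writes ?c)) s s'" and I: "?I (s ''m'' 0) s'"
    then show "?I (n * n) s' \<and> s' ''W'' = s ''W''"
      using nm unfolding wr by (auto simp: eq_outsideD[OF fr[unfolded wr]])
  qed (use nm in \<open>auto simp: upd_def\<close>)
  then show ?thesis unfolding merge_labels_def Let_def
  proof (rule runs_mono)
    fix s' assume I: "?I (n * n) s' \<and> s' ''W'' = s ''W''"
    have "s' ''L'' ((u * n + v) * n + w) = relabel S ?a ?b L u v w" if "u < n" "v < n" "w < n" for u v w
    proof -
      have "s' ''L'' ((u * n + v) * n + w) = new (u * n + v) w"
        using I that index_less[of u n v] by auto
      also have "\<dots> = relabel S ?a ?b L u v w"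
        using tab rep that ab by (auto simp: new_def relabel_def tables_def input_def repr_def)
      finally show ?thesis .
    qed
    then show "repr n (relabel S ?a ?b L) W s'" using I rep by (auto simp: repr_def)
  qed simp
qed

lemma output_edges_insert:
  assumes "a < n" "b < n" "a \<noteq> b"
  shows "output_edges n (upd s ''F'' (a * n + b) 1) = insert {a, b} (output_edges n s)"
proof -
  have "upd s ''F'' (a * n + b) 1 ''F'' (u * n + v) \<noteq> 0 \<longleftrightarrow> (u, v) = (a, b) \<or> s ''F'' (u * n + v) \<noteq> 0"
    if "u < n" "v < n" for u v
    using that assms by (auto simp: upd_def index_eq_iff)
  then show ?thesis unfolding output_edges_def using assms by blast
qed

lemma output_edges_cong: "s' ''F'' = s ''F'' \<Longrightarrow> output_edges n s' = output_edges n s"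
  by (simp add: output_edges_def)

section \<open>One round and the whole program\<close>

definition search_time :: "nat \<Rightarrow> nat" where
  "search_time n = n * (n * (n * (n * 11 + 6) + 27) + 6) + 7"

definition step_time :: "nat \<Rightarrow> nat" where
  "step_time n = n * n * (n * 5 + 11) + search_time n + 10"

text \<open>With \<open>bg > 0\<close>, the invariant \<open>best\<close> supplies the premises of a
  greedy step. The potential then falls by at least the gain \<open>bg\<close>, hence strictly, and
  the closing search restores \<open>best\<close> for the new labels and weights.\<close>

lemma runs_round:
  assumes S: "safe_sets {..<n} S"
    and tab: "tables n S s" and rep: "repr n L W s" and best: "best n S L W ({..<n} \<times> {..<n}) s"
    and bg: "0 < s ''bg'' 0" and gr: "greedy n S d (output_edges n s) L W"
  shows "runs (step_time n) (round_body d) (\<lambda>s'. \<exists>L' W'. tables n S s' \<and> repr n L' W' s' \<and>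
    best n S L' W' ({..<n} \<times> {..<n}) s' \<and> greedy n S d (output_edges n s') L' W' \<and>
    potential n S L' < potential n S L) s"
    (is "runs _ _ ?Q _")
proof -
  define a b where "a = s ''ba'' 0" and "b = s ''bb'' 0"
  have ab: "a < n" "b < n" and g: "s ''bg'' 0 = gain n S L a b" and c: "s ''bc'' 0 = W a + W b"
    using best bg by (auto simp: best_def a_def b_def)
  have neq: "a \<noteq> b" using g bg gain_pos_neq by simp
  define L' where "L' = relabel S a b L"
  define W' where "W' = reweigh d a b W"
  define F' where "F' = insert {a, b} (output_edges n s)"
  have gr': "greedy n S d F' L' W'" unfolding F'_def L'_def W'_def
    using ab g bg c best by (intro greedy.step[OF gr]) (auto simp: best_def)
  have pot: "potential n S L' < potential n S L"
    using potential_relabel[OF S, of a b L] g bg unfolding L'_def by linarith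
  \<comment> \<open>The memories after \<open>add_edge\<close> and after each of the two
    \<open>raise\<close> commands.\<close>
  define s1 where "s1 = upd s ''F'' (a * n + b) 1"
  define s2 where "s2 = upd s1 ''W'' a (W' a)"
  define s3 where "s3 = upd s2 ''W'' b (W' b)"
  have fr3: "eq_outside {''F'', ''W''} s s3"
    by (auto simp: s1_def s2_def s3_def eq_outside_def upd_def)
  have tab3: "tables n S s3" by (rule tables_cong[OF tab fr3]) auto
  have eqs3: "s3 ''ba'' 0 = a" "s3 ''bb'' 0 = b"
    by (auto simp: eq_outsideD[OF fr3] a_def b_def)
  have rep3: "repr n L W' s3"
    using rep by (auto simp: repr_def s1_def s2_def s3_def upd_def W'_def reweigh_def)
  have out3: "output_edges n s3 = F'"
  proof -
    have "output_edges n s3 = output_edges n s1"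
      by (rule output_edges_cong) (simp add: s2_def s3_def upd_def)
    then show ?thesis unfolding F'_def s1_def using output_edges_insert[OF ab neq] by simp
  qed
  have R3: "runs (n * n * (n * 5 + 11) + search_time n + 4) (Seq merge_labels search) ?Q s3"
  proof (rule runs_Seq[OF runs_conseq[OF runs_merge_labels[OF tab3 rep3] order_refl]])
    show "s3 ''ba'' 0 < n" "s3 ''bb'' 0 < n" using eqs3 ab by auto
    fix s4 assume rep4: "repr n (relabel S (s3 ''ba'' 0) (s3 ''bb'' 0) L) W' s4"
      and fr4: "eq_outside (writes merge_labels) s3 s4"
    have wr: "writes merge_labels = {''p'', ''la'', ''lb'', ''w'', ''L''}"
      by (auto simp: merge_labels_def Let_def)
    have rep4': "repr n L' W' s4" using rep4 eqs3 by (simp add: L'_def)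
    have tab4: "tables n S s4" by (rule tables_cong[OF tab3 fr4]) (auto simp: wr)
    have F4: "s4 ''F'' = s3 ''F''" by (auto simp: eq_outsideD[OF fr4] wr)
    show "runs (search_time n) search ?Q s4"
      unfolding search_time_def
    proof (rule runs_conseq[OF runs_search[OF tab4 rep4' greedy_weight_pos[OF gr']] order_refl])
      fix s5 assume best5: "best n S L' W' ({..<n} \<times> {..<n}) s5"
        and fr5: "eq_outside (writes search) s4 s5"
      have "tables n S s5" by (rule tables_cong[OF tab4 fr5]) (auto simp: writes_search)
      moreover have "repr n L' W' s5" by (rule repr_cong[OF rep4' fr5]) (auto simp: writes_search)
      moreover have "s5 ''F'' = s3 ''F''"
        using F4 by (auto simp: eq_outsideD[OF fr5] writes_search)
      then have "output_edges n s5 = F'" using output_edges_cong out3 by blast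
      ultimately show "?Q s5" using best5 gr' pot by auto
    qed
  qed simp
  have "a \<le> n * n" using ab(1) le_square[of n] by linarith
  then have A: "aval (pair ''ba'' ''bb'') s = a * n + b"
    using tab by (simp add: pair_def a_def b_def tables_def)
  have Wab: "s ''W'' a = W a" "s ''W'' b = W b" using rep ab by (auto simp: repr_def)
  have e1: "s1 ''ba'' 0 = a" "s1 ''bb'' 0 = b" "s1 ''W'' = s ''W''"
    by (auto simp: s1_def upd_def a_def b_def)
  \<comment> \<open>As \<open>a\<close> and \<open>b\<close> differ, raising the weight of
    \<open>a\<close> leaves that of \<open>b\<close> intact.\<close>
  have e2: "s2 ''bb'' 0 = b" "s2 ''W'' b = W b"
    using neq e1 Wab by (auto simp: s2_def upd_def)
  have 1: "upd s ''F'' (aval (pair ''ba'' ''bb'') s) (aval (Const 1) s) = s1"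
    by (simp add: A s1_def)
  have 2: "upd s1 ''W'' (aval (Var ''ba'') s1) (aval (Plus (Cell ''W'' (Var ''ba''))
      (if d then Cell ''W'' (Var ''ba'') else Const 0)) s1) = s2"
    using e1 Wab by (simp add: s2_def W'_def reweigh_def mult_2)
  have 3: "upd s2 ''W'' (aval (Var ''bb'') s2) (aval (Plus (Cell ''W'' (Var ''bb''))
      (if d then Cell ''W'' (Var ''bb'') else Const 0)) s2) = s3"
    using e2 by (simp add: s3_def W'_def reweigh_def mult_2)
  have "runs (n * n * (n * 5 + 11) + search_time n + 6)
      (Seq (raise d ''bb'') (Seq merge_labels search)) ?Q s2"
    unfolding raise_def by (rule runs_Seq_Assign, unfold 3, rule R3) simp
  then have "runs (n * n * (n * 5 + 11) + search_time n + 8)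
      (Seq (raise d ''ba'') (Seq (raise d ''bb'') (Seq merge_labels search))) ?Q s1"
    unfolding raise_def[of d "''ba''"] by (intro runs_Seq_Assign) (simp_all only: 2, simp)
  then show ?thesis unfolding round_body_def add_edge_def step_time_def
    by (intro runs_Seq_Assign) (simp_all only: 1, simp)
qed

lemma runs_program:
  assumes S: "safe_sets {..<n} S"
  shows "runs ((n + n * n) * 4 + n * n * (n * 4 + 6) + n * 4 + search_time n +
      (n ^ 3 + 1) * (step_time n + 1) + 50) (program d)
    (\<lambda>s. \<exists>L W. greedy n S d (output_edges n s) L W \<and> (\<forall>a<n. \<forall>b<n. gain n S L a b = 0)) (encode n S)"
proof -
  let ?L = "\<lambda>u v w. w" and ?W = "\<lambda>v. 1"
  let ?loop = "While (Less (Const 0) (Var ''bg'')) (round_body d)"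
  let ?Q = "\<lambda>s. \<exists>L W. greedy n S d (output_edges n s) L W \<and> (\<forall>a<n. \<forall>b<n. gain n S L a b = 0)"
  let ?T = "(n ^ 3 + 1) * (step_time n + 1) + 1"
  \<comment> \<open>The potential serves as loop index, so there are at most \<open>n ^ 3\<close>
    rounds; one round may lower it by more than one.\<close>
  define I where "I k s \<longleftrightarrow> (\<exists>L W. tables n S s \<and> repr n L W s \<and> best n S L W ({..<n} \<times> {..<n}) s \<and>
      greedy n S d (output_edges n s) L W \<and> k = potential n S L)" for k s
  have loop: "runs ?T ?loop ?Q s" if I: "I k s" for k s
  proof -
    have k: "k \<le> n ^ 3" using I potential_le[OF S] by (auto simp: I_def)
    have "runs (k * (step_time n + 1) + 1) ?loop
        (\<lambda>s'. (\<exists>j. I j s') \<and> \<not> bval (Less (Const 0) (Var ''bg'')) s') s"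
    proof (rule runs_While[where I = I, OF I])
      fix k s assume "I k s" "bval (Less (Const 0) (Var ''bg'')) s"
      then obtain L W where *: "tables n S s" "repr n L W s" "best n S L W ({..<n} \<times> {..<n}) s"
        "greedy n S d (output_edges n s) L W" "k = potential n S L" "0 < s ''bg'' 0"
        by (auto simp: I_def)
      show "runs (step_time n) (round_body d) (\<lambda>s'. \<exists>j<k. I j s') s"
        using runs_round[OF S *(1,2,3,6,4)] by (rule runs_mono) (auto simp: I_def *(5))
    qed simp
    then show ?thesis
    proof (rule runs_mono)
      show "k * (step_time n + 1) + 1 \<le> ?T" using k by (intro add_mono mult_right_mono) auto
      fix s' assume "(\<exists>j. I j s') \<and> \<not> bval (Less (Const 0) (Var ''bg'')) s'"
      then obtain L W where *: "best n S L W ({..<n} \<times> {..<n}) s'"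
        "greedy n S d (output_edges n s') L W" "s' ''bg'' 0 = 0"
        by (auto simp: I_def)
      \<comment> \<open>With \<open>bg = 0\<close> the right-hand side in \<open>best\<close>
        vanishes, and \<open>bc > 0\<close> forces the gain to vanish as well.\<close>
      then have "gain n S L a b = 0" if "a < n" "b < n" for a b
        using that by (auto simp: best_def)
      then show "?Q s'" using *(2) by blast
    qed
  qed
  have enc: "encode n S ''M'' 0 = 0" "encode n S ''F'' = (\<lambda>_. 0)"
    by (auto simp: encode_def)
  have w: "writes init_multiples = {''M'', ''i'', ''m''}" "writes init_labels = {''p'', ''w'', ''L''}"
    "writes init_weights = {''v'', ''W''}"
    by (auto simp: init_multiples_def init_labels_def init_weights_def Let_def)
  have search: "runs (search_time n + ?T + 1) (Seq search ?loop) ?Q s"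
    if tab: "tables n S s" and rep: "repr n ?L ?W s" and F: "s ''F'' = (\<lambda>_. 0)" for s
  proof (rule runs_Seq)
    show "runs (search_time n) search (\<lambda>s'. runs ?T ?loop ?Q s') s"
      unfolding search_time_def
    proof (rule runs_conseq[OF runs_search[OF tab rep] order_refl])
      fix s' assume best: "best n S ?L ?W ({..<n} \<times> {..<n}) s'" and fr: "eq_outside (writes search) s s'"
      have tab': "tables n S s'" by (rule tables_cong[OF tab fr]) (auto simp: writes_search)
      have rep': "repr n ?L ?W s'" by (rule repr_cong[OF rep fr]) (auto simp: writes_search)
      have "s' ''F'' = (\<lambda>_. 0)" using F by (auto simp: eq_outsideD[OF fr] writes_search)
      then have "output_edges n s' = {}" by (auto simp: output_edges_def)
      then have "I (potential n S ?L) s'"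
        unfolding I_def using tab' rep' best greedy.init[of n S d] by metis
      then show "runs ?T ?loop ?Q s'" by (rule loop)
    qed simp
  qed simp
  show ?thesis
    unfolding program_def
  proof (rule runs_Seq[OF runs_conseq[OF runs_init_multiples[OF input_encode enc(1)] order_refl]])
    fix s1 assume tab1: "tables n S s1" and fr1: "eq_outside (writes init_multiples) (encode n S) s1"
    have F1: "s1 ''F'' = (\<lambda>_. 0)" using enc(2) by (auto simp: eq_outsideD[OF fr1] w)
    show "runs (n * n * (n * 4 + 6) + n * 4 + search_time n + ?T + 20)
        (Seq init_labels (Seq init_weights (Seq search ?loop))) ?Q s1"
    proof (rule runs_Seq[OF runs_conseq[OF runs_init_labels[OF tab1] order_refl]])
      fix s2 assume L: "\<forall>u<n. \<forall>v<n. \<forall>w<n. s2 ''L'' ((u * n + v) * n + w) = w"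
        and fr2: "eq_outside (writes init_labels) s1 s2"
      have F2: "s2 ''F'' = (\<lambda>_. 0)" using F1 by (auto simp: eq_outsideD[OF fr2] w)
      have tab2: "tables n S s2" by (rule tables_cong[OF tab1 fr2]) (auto simp: w)
      then have n2: "s2 ''n'' 0 = n" by (auto simp: tables_def input_def)
      show "runs (n * 4 + search_time n + ?T + 10) (Seq init_weights (Seq search ?loop)) ?Q s2"
      proof (rule runs_Seq[OF runs_conseq[OF runs_init_weights[where s = s2 and n = n, OF n2] order_refl]])
        fix s3 assume W: "\<forall>v<n. s3 ''W'' v = 1" and fr3: "eq_outside (writes init_weights) s2 s3"
        have "s3 ''F'' = (\<lambda>_. 0)" using F2 by (auto simp: eq_outsideD[OF fr3] w)
        moreover have "tables n S s3" by (rule tables_cong[OF tab2 fr3]) (auto simp: w)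
        moreover have "s3 ''L'' = s2 ''L''" by (auto simp: eq_outsideD[OF fr3] w)
        then have "repr n ?L ?W s3" using L W by (simp add: repr_def)
        ultimately show "runs (search_time n + ?T + 1) (Seq search ?loop) ?Q s3"
          by (intro search)
      qed simp
    qed simp
  qed simp
qed

section \<open>Polynomial time and success probability\<close>

definition time_poly :: "nat poly" where
  "time_poly = (let n = [:0, 1:]; s = n * (n * (n * (n * 11 + 6) + 27) + 6) + 7 in
     (n + n * n) * 4 + n * n * (n * 4 + 6) + n * 4 + s +
      (n ^ 3 + 1) * (n * n * (n * 5 + 11) + s + 10 + 1) + 50)"

lemma poly_time_poly:
  "poly time_poly n = (n + n * n) * 4 + n * n * (n * 4 + 6) + n * 4 + search_time n +
      (n ^ 3 + 1) * (step_time n + 1) + 50"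
  by (simp add: time_poly_def Let_def search_time_def step_time_def algebra_simps)

lemma program_outcome:
  assumes "safe_sets {..<n} S"
  obtains t s' L W where "t \<le> poly time_poly n" "\<And>r. exec (program d) (encode n S) r t s' r"
    "greedy n S d (output_edges n s') L W"
    "output_edges n s' \<in> solutions {..<n} ([{..<n}]\<^bsup>2\<^esup>) S"
proof -
  obtain t s' L W where *: "t \<le> poly time_poly n" "\<forall>r. exec (program d) (encode n S) r t s' r"
    "greedy n S d (output_edges n s') L W" "\<forall>a<n. \<forall>b<n. gain n S L a b = 0"
    using runs_program[OF assms, of d] unfolding runs_def poly_time_poly by blast
  with greedy_solution[OF assms *(3)] show ?thesis by (intro that) auto
qed

lemma program_polynomial_time: "polynomial_time (program d) time_poly"
  unfolding polynomial_time_def by (metis program_outcome)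

text \<open>The run does not depend on the tape, so the success event is the whole space and has
  probability 1, whatever the exponent \<open>e\<close>.\<close>

lemma program_approximates:
  assumes "\<And>n S E F L W. safe_sets {..<n} S \<Longrightarrow> E \<in> solutions {..<n} ([{..<n}]\<^bsup>2\<^esup>) S \<Longrightarrow> 1 \<le> n \<Longrightarrow>
    greedy n S d F L W \<Longrightarrow> real (cost {..<n} F) \<le> factor n * cost {..<n} E"
  shows "approximates cost factor e (program d) time_poly"
  unfolding approximates_def
proof (intro allI impI)
  fix n :: nat and S assume n: "1 \<le> n" and S: "safe_sets {..<n} S"
  let ?G = "[{..<n}]\<^bsup>2\<^esup>" and ?R = "{r :: bool list. length r = poly time_poly n}"
  let ?A = "{r. \<exists>t s' r'. exec (program d) (encode n S) r t s' r' \<and>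
               output_edges n s' \<in> solutions {..<n} ?G S \<and>
               real (cost {..<n} (output_edges n s')) \<le> factor n * real (opt cost {..<n} ?G S)}"
  obtain t s' L W where run: "\<And>r. exec (program d) (encode n S) r t s' r"
    and gr: "greedy n S d (output_edges n s') L W"
    and sol: "output_edges n s' \<in> solutions {..<n} ?G S"
    by (rule program_outcome[OF S, where d = d]) (rule that)
  \<comment> \<open>The output itself shows that solutions exist, so the infimum of natural numbers
    is attained by some \<open>E\<close>.\<close>
  have "(INF F \<in> solutions {..<n} ?G S. cost {..<n} F) \<in> cost {..<n} ` solutions {..<n} ?G S"
    using sol by (intro Inf_nat_def1) blast
  then obtain E where "E \<in> solutions {..<n} ?G S" "opt cost {..<n} ?G S = cost {..<n} E"
    unfolding opt_def by auto
  then have "real (cost {..<n} (output_edges n s')) \<le> factor n * real (opt cost {..<n} ?G S)"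
    using assms[OF S _ n gr] by simp
  then have "r \<in> ?A" for r using run sol by (intro CollectI exI conjI)
  then have A: "?A = UNIV" by (intro UNIV_eq_I[symmetric])
  show "1 - 1 / real n ^ e \<le> measure_pmf.prob (pmf_of_set ?R) ?A"
    unfolding A by simp
qed

theorem theorem5:
  shows "has_randomized_approximation num_edges (soft_O (\<lambda>n. sqrt (real n))) \<and>
         has_randomized_approximation max_degree (soft_O (\<lambda>n. sqrt (real n)))"
proof -
  have "approximates num_edges factor e (program False) time_poly" for e
    by (rule program_approximates) (rule greedy_approximates_edges)
  moreover have "approximates max_degree factor e (program True) time_poly" for e
    by (rule program_approximates) (rule greedy_approximates_degree)
  ultimately show ?thesis
    unfolding has_randomized_approximation_def
    using factor_soft_O program_polynomial_time by blast
qed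

end
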